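(* Let $(X,d,\mathcal A,\lambda,T)$ be an expanding system whose partition $\mathcal P_0$ has finite entropy $H_\mu(\mathcal P_0)=\sum_{P\in\mathcal P_0}\mu(P)\log\frac1{\mu(P)}$, where $\mu$ is the ACIPM of the system. Let $\{r_n\}_{n\ge1}$ be a non-increasing sequence of positive numbers. Then for $\lambda$-almost every $x_0\in X$ the following holds: if $\sum_{n=1}^\infty r_n^{\delta}=\infty$ for some $\delta>\overline{\delta}_\lambda(x_0)$, then the set $$\mathcal W(x_0,\{r_n\})=\{x\in X:\ d(T^n(x),x_0)<r_n\ \text{for infinitely many } n\}$$ has full $\lambda$-measure, and moreover $$\liminf_{n\to\infty}\frac{d(T^n(x),x_0)}{r_n}=0\qquad\text{for } \lambda\text{-almost all } x\in X.$$
   Context: Expanding systems. $(X,d)$ is a locally complete separable metric space with Borel $\sigma$-algebra $\mathcal A$, and $\lambda$ is a finite non-atomic measure on $\mathcal A$ whose support is $X$. $(X,d,\mathcal A,\lambda,T)$ is an expanding system if $T:X\to X$ is measurable and satisfies: (A) There is a collection of open sets $\mathcal P_0=\{P_i\}$ of $X$ with $\sup_{P\in\mathcal P_0}\mathrm{diam}(P)<\infty$ such that (1) $\lambda(P_i)>0$; (2) $P_i\cap P_j=\emptyset$ if $i\ne j$; (3) $\lambda(X\setminus\cup_iP_i)=0$; (4) $T|_{P_i}$ is injective; (5) if $P_j\cap T(P_i)\neq\emptyset$ then $P_j\subseteq T(P_i)$; (6) if $P_j\subseteq T(P_i)$ then the map $(T|_{P_i})^{-1}:T(P_i)\cap P_j\to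 P_i$ is open; (7) there is a natural number $n_0>0$ with $\lambda(T^{-n_0}(P_i)\cap P_j)>0$ for all $P_i,P_j\in\mathcal P_0$. (B) There is a measurable $\mathbf J:X\to[0,\infty)$, $\mathbf J>0$ on $\cup_{P\in\mathcal P_0}P$, such that $\lambda(T(A))=\int_A\mathbf J\,d\lambda$ for every $P_i\in\mathcal P_0$ and every Borel $A\subset P_i$; and there are constants $0<\alpha\le1$, $C_1>0$ such that $\left|\frac{\mathbf J(x)}{\mathbf J(y)}-1\right|\le C_1\,d(T(x),T(y))^\alpha$ for all $x,y\in P_i$ and all $i$. (C) Define inductively $\mathcal P_n=\bigcup_{P_i\in\mathcal P_0}\{(T|_{P_i})^{-1}(P_j):\ P_j\in\mathcal P_{n-1},\ P_j\subset T(P_i)\}$ for $n\ge1$. There are constants $\beta>1$, $C_2>0$ such that $d(T^n(x),T^n(y))\ge C_2\beta^n d(x,y)$ whenever $x,y$ lie in the same element of $\mathcal P_n$. Here $T^n$ is the $n$-fold composition. ACIPM. There exists a unique $T$-invariant probability measure $\mu$ on $\mathcal A$ absolutely continuous with respect to $\lambda$; it is called the ACIPM of the system. Blocks and dimension. $X_0=\bigcap_{n\ge0}\bigcup_{P\in\mathcal P_n}P$ (a set of full $\lambda$-measure). For $x\in X_0$, $P(n,x)$ is the element of $\mathcal P_n$ containing $x$, and $\overline\delta_\lambda(x)=\limsup_{n\to\infty}\frac{\log\lambda(P(n,x))}{\log\mathrm{diam}(P(n,x))}$. *)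

theory Defs
  imports "HOL-Probability.Probability_Measure"
begin

definition nonatomic :: "'a measure \<Rightarrow> bool" where
  "nonatomic M \<longleftrightarrow>
     (\<forall>A\<in>sets M. 0 < emeasure M A \<longrightarrow>
        (\<exists>B\<in>sets M. B \<subseteq> A \<and> 0 < emeasure M B \<and> emeasure M B < emeasure M A))"

definition measure_support :: "'a::topological_space measure \<Rightarrow> 'a set" where
  "measure_support M = {x. \<forall>U. open U \<and> x \<in> U \<longrightarrow> 0 < emeasure M U}"

text \<open>
  The collection \<open>blocks T P0 n\<close> is \<open>\<P>\<^sub>n\<close>. When \<open>T\<close> is injective on \<open>P\<close> and \<open>Q \<subseteq> T ` P\<close>, the
  set \<open>P \<inter> T -` Q\<close> is the image of \<open>Q\<close> under the inverse branch of \<open>T\<close> into \<open>P\<close>.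
\<close>

primrec blocks :: "('a \<Rightarrow> 'a) \<Rightarrow> 'a set set \<Rightarrow> nat \<Rightarrow> 'a set set" where
  "blocks T P0 0 = P0"
| "blocks T P0 (Suc n) = (\<Union>P\<in>P0. {P \<inter> T -` Q | Q. Q \<in> blocks T P0 n \<and> Q \<subseteq> T ` P})"

text \<open>
  The space \<open>X\<close> is the whole type, and separability is expressed by the class
  \<open>second_countable_topology\<close>. The finite bound on the diameters is stated together with
  boundedness because \<open>diameter\<close> is an unspecified real number on unbounded sets. The equation in
  \<open>jacobian\<close> presupposes that \<open>T ` A\<close> belongs to the \<open>\<sigma>\<close>-algebra; this is recorded explicitly
  since \<open>emeasure\<close> is \<open>0\<close> on non-measurable sets. (It is no extra restriction: a locally complete
  separable metric space is Polish, so injective Borel images of Borel sets are Borel by the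
  Lusin-Souslin theorem.)
\<close>

locale expanding_system = finite_measure lam
  for lam :: "'a::{metric_space, second_countable_topology} measure" +
  fixes T :: "'a \<Rightarrow> 'a" and P0 :: "'a set set"
  assumes locally_complete: "locally complete (UNIV :: 'a set)"
    and sets_lam: "sets lam = sets borel"
    and nonatomic_lam: "nonatomic lam"
    and support_lam: "measure_support lam = UNIV"
    and measurable_T: "T \<in> borel_measurable borel"
    and open_partition: "\<forall>P\<in>P0. open P"
    and diameter_partition: "\<exists>D. \<forall>P\<in>P0. bounded P \<and> diameter P \<le> D"
    and positive_partition: "\<forall>P\<in>P0. 0 < emeasure lam P"
    and disjoint_partition: "\<forall>P\<in>P0. \<forall>Q\<in>P0. P \<noteq> Q \<longrightarrow> P \<inter> Q = {}"
    and null_partition: "emeasure lam (UNIV - \<Union>P0) = 0"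
    and inj_branch: "\<forall>P\<in>P0. inj_on T P"
    and markov: "\<forall>P\<in>P0. \<forall>Q\<in>P0. Q \<inter> T ` P \<noteq> {} \<longrightarrow> Q \<subseteq> T ` P"
    and open_inverse_branch:
      "\<forall>P\<in>P0. \<forall>Q\<in>P0. Q \<subseteq> T ` P \<longrightarrow>
         open_map (top_of_set (T ` P \<inter> Q)) (top_of_set P) (inv_into P T)"
    and transitive:
      "\<exists>n0>0. \<forall>P\<in>P0. \<forall>Q\<in>P0. 0 < emeasure lam ((T ^^ n0) -` P \<inter> Q)"
    and jacobian:
      "\<exists>J :: 'a \<Rightarrow> real.
         J \<in> borel_measurable borel \<and> (\<forall>x. 0 \<le> J x) \<and> (\<forall>x\<in>\<Union>P0. 0 < J x) \<and>
         (\<forall>P\<in>P0. \<forall>A\<in>sets borel. A \<subseteq> P \<longrightarrow>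
            T ` A \<in> sets borel \<and>
            emeasure lam (T ` A) = (\<integral>\<^sup>+ x\<in>A. ennreal (J x) \<partial>lam)) \<and>
         (\<exists>\<alpha> C1. 0 < \<alpha> \<and> \<alpha> \<le> 1 \<and> 0 < C1 \<and>
            (\<forall>P\<in>P0. \<forall>x\<in>P. \<forall>y\<in>P. \<bar>J x / J y - 1\<bar> \<le> C1 * dist (T x) (T y) powr \<alpha>))"
    and expansion:
      "\<exists>\<beta> C2 :: real. 1 < \<beta> \<and> 0 < C2 \<and>
         (\<forall>n. \<forall>P\<in>blocks T P0 n. \<forall>x\<in>P. \<forall>y\<in>P.
            C2 * \<beta> ^ n * dist x y \<le> dist ((T ^^ n) x) ((T ^^ n) y))"

definition is_acipm :: "'a::topological_space measure \<Rightarrow> ('a \<Rightarrow> 'a) \<Rightarrow> 'a measure \<Rightarrow> bool" where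
  "is_acipm lam T mu \<longleftrightarrow>
     prob_space mu \<and> sets mu = sets borel \<and>
     (\<forall>A\<in>sets borel. emeasure mu (T -` A) = emeasure mu A) \<and>
     absolutely_continuous lam mu"

text \<open>The value \<open>\<infinity>\<close> is allowed. Null sets contribute \<open>0\<close> since \<open>ln (1 / 0) = 0\<close> in HOL.\<close>

definition partition_entropy :: "'a measure \<Rightarrow> 'a set set \<Rightarrow> ennreal" where
  "partition_entropy mu P0 =
     (\<Sum>\<^sub>\<infinity>P\<in>P0. ennreal (measure mu P * ln (1 / measure mu P)))"

text \<open>
  For an expanding system, \<open>block T P0 n x\<close> and \<open>upper_dim lam T P0 x\<close> are meaningful for \<open>x\<close> in
  \<open>(\<Inter>n. \<Union>(blocks T P0 n))\<close>, a set of full measure on which the block containing \<open>x\<close> is unique.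
  Finitely many \<open>n\<close> with degenerate logarithms do not affect the upper limit.
\<close>

definition block :: "('a \<Rightarrow> 'a) \<Rightarrow> 'a set set \<Rightarrow> nat \<Rightarrow> 'a \<Rightarrow> 'a set" where
  "block T P0 n x = (THE P. P \<in> blocks T P0 n \<and> x \<in> P)"

definition upper_dim ::
    "'a::metric_space measure \<Rightarrow> ('a \<Rightarrow> 'a) \<Rightarrow> 'a set set \<Rightarrow> 'a \<Rightarrow> ereal" where
  "upper_dim lam T P0 x =
     limsup (\<lambda>n. ereal (ln (measure lam (block T P0 n x)) / ln (diameter (block T P0 n x))))"

definition target_set :: "('a::metric_space \<Rightarrow> 'a) \<Rightarrow> 'a \<Rightarrow> (nat \<Rightarrow> real) \<Rightarrow> 'a set" where
  "target_set T x0 r = {x. infinite {n. 1 \<le> n \<and> dist ((T ^^ n) x) x0 < r n}}"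

end

theory Submission
  imports Defs
begin

text \<open>
  Blocks around \<open>x0\<close> inside the balls of radius \<open>r n\<close> serve as targets. Bounded distortion makes
  their preimages quasi-independent with respect to \<open>lam\<close>, up to an error governed by the measures
  of the blocks at the return times of \<open>x0\<close> to its cell; these are summable. The Kochen--Stone
  inequality then gives a hitting set of positive measure, which is forward invariant because \<open>r\<close> is
  non-increasing, and hence has full measure by ergodicity. Invariance of \<open>mu\<close> enters through
  Poincare recurrence and through a uniform lower bound on the measure of the preimages of a cell.
  Finite entropy and a Borel--Cantelli argument show that along the blocks of almost every \<open>x0\<close> the
  measure drops subexponentially from one level to the next, so that a block of measure at least
  \<open>r n powr \<delta>\<close> fits into the ball of radius \<open>r n\<close>.
\<close>

section \<open>Regularity and the Kochen--Stone inequality\<close>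

text \<open>Distortion controls \<open>lam\<close> only and invariance holds for \<open>mu\<close>
  only, while the density of \<open>mu\<close> is not assumed bounded above or away from 0. The
  correlation estimates are therefore made for \<open>lam\<close>, and almost-everywhere statements
  about \<open>mu\<close> are transferred by \<open>lam_ac\<close>, itself a consequence of the
  ergodicity argument. Blocks are preferred to balls because \<open>T ^^ n\<close> maps a
  level-\<open>n\<close> block onto a whole cell: pulling back creates no boundary terms, and no
  rate of mixing is required. The only strong correlations left are short returns of a target to
  itself; their total cost is the sum of \<open>return_measure\<close>, finite at every point of
  \<open>X0\<close>. The price is that \<open>P0\<close> may be infinite, so that a block can be far
  smaller than its predecessor. Entropy makes this loss subexponential, diameters of blocks decay
  exponentially, and the gap between \<delta> and the upper dimension leaves a power of the radius
  to pay for it. The conditions imposed on \<open>x0\<close> mention neither \<open>r\<close> nor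
  \<delta>, so one null set serves for all of them.\<close>

lemma open_inner_approx:
  fixes M :: "'a::metric_space measure"
  assumes fin: "finite_measure M" and M: "sets M = sets borel" and S: "open S" and e: "0 < e"
  shows "\<exists>F. closed F \<and> F \<subseteq> S \<and> measure M (S - F) < e"
\<comment> \<open>The whole space is treated apart because \<open>infdist\<close> to the empty set
  is 0 by convention.\<close>
proof (cases "S = UNIV")
  case True
  then show ?thesis using e by (intro exI[of _ UNIV]) auto
next
  interpret finite_measure M by fact
  case False
  then have ne: "- S \<noteq> {}" by auto
  define F where "F n = {x. inverse (real (Suc n)) \<le> infdist x (- S)}" for n
  have cl: "closed (F n)" for n
    unfolding F_def by (intro closed_Collect_le continuous_intros)
  have sub: "F n \<subseteq> S" for n
  proof
    fix x assume "x \<in> F n"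
    then have "infdist x (- S) > 0"
      unfolding F_def by (smt (verit) inverse_positive_iff_positive mem_Collect_eq of_nat_0_less_iff zero_less_Suc)
    then show "x \<in> S"
      using infdist_zero[of x "- S"] by (cases "x \<in> S") auto
  qed
  have inc: "x \<in> S \<Longrightarrow> \<exists>n. x \<in> F n" for x
  proof -
    assume "x \<in> S"
    then have "infdist x (- S) \<noteq> 0"
      using in_closed_iff_infdist_zero[of "- S" x] S ne by auto
    then have "infdist x (- S) > 0"
      using infdist_nonneg[of x "- S"] by linarith
    then show ?thesis
      unfolding F_def using reals_Archimedean less_imp_le by (metis mem_Collect_eq)
  qed
  have dec: "decseq (\<lambda>n. S - F n)"
  proof (rule decseq_SucI)
    fix n
    have "inverse (real (Suc (Suc n))) \<le> inverse (real (Suc n))"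
      by (intro le_imp_inverse_le) auto
    then show "S - F (Suc n) \<subseteq> S - F n"
      unfolding F_def using order_trans by blast
  qed
  have "(\<lambda>n. measure M (S - F n)) \<longlonglongrightarrow> measure M (\<Inter>n. S - F n)"
    using dec cl S by (intro finite_Lim_measure_decseq) (auto simp: M)
  moreover have "(\<Inter>n. S - F n) = {}" using inc by auto
  ultimately have "eventually (\<lambda>n. measure M (S - F n) < e) sequentially"
    using e by (metis measure_empty order_tendstoD(2))
  then obtain n where "measure M (S - F n) < e"
    by (auto simp: eventually_sequentially)
  then show ?thesis using cl sub by blast
qed

text \<open>Closed inner and open outer approximation are proved together so that the complement
  step of the induction merely exchanges their roles.\<close>

lemma borel_regular_approx:
  fixes M :: "'a::metric_space measure"
  assumes fin: "finite_measure M" and M: "sets M = sets borel" and A: "A \<in> sets borel" and e: "0 < e"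
  shows "\<exists>F U. closed F \<and> open U \<and> F \<subseteq> A \<and> A \<subseteq> U \<and> measure M (U - F) < e"
proof -
  interpret finite_measure M by fact
  have [simp]: "open U \<Longrightarrow> U \<in> sets M" "closed U \<Longrightarrow> U \<in> sets M" for U :: "'a set"
    by (auto simp: M)
  have "A \<in> sigma_sets UNIV {S. open S}"
    using A by (simp add: borel_def)
  then show ?thesis using e
  proof (induction arbitrary: e rule: sigma_sets.induct)
    case (Basic S)
    then show ?case using open_inner_approx[OF fin M, of S e] by auto
  next
    case Empty
    then show ?case by (intro exI[of _ "{}"]) auto
  next
    case (Compl S)
    then obtain F U where *: "closed F" "open U" "F \<subseteq> S" "S \<subseteq> U" "measure M (U - F) < e"
      using Compl.IH[OF Compl.prems] by blast
    have "(- F) - (- U) = U - F" by auto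
    then show ?case using * by (intro exI[of _ "- U"] exI[of _ "- F"]) (auto simp: Compl_eq_Diff_UNIV[symmetric])
  next
    case (Union S)
    \<comment> \<open>These errors add up to \<open>e / 4\<close>; another \<open>e / 2\<close> is
      reserved for the tail \<open>G n\<close>.\<close>
    define d where "d n = e / 2 * (1/2) ^ (Suc (Suc n))" for n :: nat
    have d: "d n > 0" for n using Union.prems by (auto simp: d_def)
    have "\<exists>F U. closed F \<and> open U \<and> F \<subseteq> S n \<and> S n \<subseteq> U \<and> measure M (U - F) < d n" for n
      by (rule Union.IH[OF d])
    then obtain F U where FU: "\<And>n. closed (F n)" "\<And>n. open (U n)" "\<And>n. F n \<subseteq> S n"
        "\<And>n. S n \<subseteq> U n" "\<And>n. measure M (U n - F n) < d n"
      by metis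
    have sumd: "d sums (e / 4)"
    proof -
      have "(\<lambda>n. (1/2::real) ^ n) sums 2"
        using geometric_sums[of "1/2::real"] by simp
      from sums_mult[OF this, of "e / 8"] show ?thesis
        by (simp add: d_def[abs_def] algebra_simps)
    qed
    have summ: "summable (\<lambda>n. measure M (U n - F n))"
      by (rule summable_comparison_test'[OF sums_summable[OF sumd], of 0])
         (use FU(5) less_imp_le in auto)
    have 1: "measure M (\<Union>n. U n - F n) \<le> e / 4"
    proof -
      have "measure M (\<Union>n. U n - F n) \<le> (\<Sum>n. measure M (U n - F n))"
        using summ FU by (intro finite_measure_subadditive_countably) auto
      also have "\<dots> \<le> suminf d"
        using FU(5) by (intro suminf_le[OF _ summ sums_summable[OF sumd]] less_imp_le) auto
      also have "\<dots> = e / 4" using sumd by (simp add: sums_iff)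
      finally show ?thesis .
    qed
    \<comment> \<open>A countable union of closed sets need not be closed, so only finitely many
      \<open>F i\<close> are kept; the remainders decrease to the empty set.\<close>
    define G where "G n = (\<Union>i. F i) - (\<Union>i\<le>n. F i)" for n
    have Gs: "G n \<in> sets M" for n
      unfolding G_def using FU by (intro sets.Diff sets.countable_UN sets.finite_UN) auto
    have "(\<lambda>n. measure M (G n)) \<longlonglongrightarrow> measure M (\<Inter>n. G n)"
    proof (rule finite_Lim_measure_decseq)
      show "decseq G" unfolding G_def by (rule decseq_SucI) (auto simp: le_Suc_eq)
    qed (use Gs in auto)
    moreover have "(\<Inter>n. G n) = {}" unfolding G_def by auto
    ultimately have "eventually (\<lambda>n. measure M (G n) < e / 2) sequentially"
      using Union.prems by (metis half_gt_zero measure_empty order_tendstoD(2))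
    then obtain n where n: "measure M (G n) < e / 2"
      by (auto simp: eventually_sequentially)
    have UN: "(\<Union>n. U n - F n) \<in> sets M"
      using FU by (intro sets.countable_UN) auto
    have "measure M ((\<Union>i. U i) - (\<Union>i\<le>n. F i)) \<le> measure M ((\<Union>n. U n - F n) \<union> G n)"
      using UN Gs by (intro finite_measure_mono) (auto simp: G_def)
    also have "\<dots> \<le> measure M (\<Union>n. U n - F n) + measure M (G n)"
      using UN Gs by (intro measure_Un_le) auto
    also have "\<dots> < e" using 1 n Union.prems by linarith
    finally have "measure M ((\<Union>i. U i) - (\<Union>i\<le>n. F i)) < e" .
    moreover have "closed (\<Union>i\<le>n. F i)" "open (\<Union>i. U i)"
      using FU by (auto intro: closed_UN)
    moreover have "(\<Union>i\<le>n. F i) \<subseteq> (\<Union>i. S i)" "(\<Union>i. S i) \<subseteq> (\<Union>i. U i)"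
      using FU(3,4) by blast+
    ultimately show ?case by blast
  qed
qed

lemma borel_outer_approx:
  fixes M :: "'a::metric_space measure"
  assumes fin: "finite_measure M" and M: "sets M = sets borel" and A: "A \<in> sets borel" and e: "0 < e"
  obtains U where "open U" "A \<subseteq> U" "measure M (U - A) < e"
proof -
  interpret finite_measure M by fact
  obtain F U where FU: "closed F" "open U" "F \<subseteq> A" "A \<subseteq> U" "measure M (U - F) < e"
    using borel_regular_approx[OF assms] by blast
  have "measure M (U - A) \<le> measure M (U - F)"
    using FU A by (intro finite_measure_mono) (auto simp: M)
  then show ?thesis using FU that by force
qed

text \<open>
  A Paley--Zygmund argument: with \<open>N = \<Sum>n<k. 1\<^bsub>E n\<^esub>\<close> and \<open>t = 1 / (K s)\<close>, integrate the pointwise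
  bound \<open>N \<le> a + (t N\<^sup>2 + 1\<^bsub>N > a\<^esub> / t) / 2\<close>.
\<close>

lemma (in finite_measure) kochen_stone:
  fixes E :: "nat \<Rightarrow> 'a set"
  assumes E [measurable]: "\<And>n. E n \<in> sets M"
    and div: "\<not> summable (\<lambda>n. measure M (E n))"
    and K: "0 < K"
    and second_moment: "\<And>k. 1 \<le> (\<Sum>n<k. measure M (E n)) \<Longrightarrow>
       (\<Sum>m<k. \<Sum>n<k. measure M (E m \<inter> E n)) \<le> K * (\<Sum>n<k. measure M (E n))\<^sup>2"
  shows "0 < measure M {x \<in> space M. infinite {n. x \<in> E n}}"
proof -
  define s where "s k = (\<Sum>n<k. measure M (E n))" for k
  define N where "N k x = (\<Sum>n<k. indicator (E n) x :: real)" for k x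
  define H where "H a = {x \<in> space M. \<exists>k. N k x > real a}" for a :: nat
  have Nm [measurable]: "N k \<in> borel_measurable M" for k
    unfolding N_def by measurable
  have Hm [measurable]: "H a \<in> sets M" for a
    unfolding H_def by measurable
  have unb: "\<exists>k0. \<forall>k\<ge>k0. s k > b" for b
  proof -
    have "\<exists>k. s k > b"
    proof (rule ccontr)
      assume "\<not> ?thesis"
      then have "\<And>k. s k \<le> b" by (auto simp: not_less)
      then have "summable (\<lambda>n. measure M (E n))"
        unfolding s_def by (intro summableI_nonneg_bounded[where x = b]) auto
      with div show False ..
    qed
    then obtain k0 where "s k0 > b" ..
    moreover have "k \<ge> k0 \<Longrightarrow> s k \<ge> s k0" for k
      unfolding s_def by (intro sum_mono2) auto
    ultimately show ?thesis by (meson less_le_trans)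
  qed
  have iN: "integrable M (N k)" for k
    unfolding N_def by (auto intro!: Bochner_Integration.integrable_sum simp: emeasure_eq_measure)
  have N2: "(N k x)\<^sup>2 = (\<Sum>m<k. \<Sum>n<k. indicator (E m \<inter> E n) x)" for k x
    unfolding N_def power2_eq_square by (simp add: sum_product indicator_inter_arith)
  have iN2: "integrable M (\<lambda>x. (N k x)\<^sup>2)" for k
    unfolding N2 by (auto intro!: Bochner_Integration.integrable_sum simp: emeasure_eq_measure)
  have IN: "(\<integral>x. N k x \<partial>M) = s k" for k
    unfolding N_def s_def by (subst Bochner_Integration.integral_sum) (auto simp: emeasure_eq_measure)
  have IN2: "(\<integral>x. (N k x)\<^sup>2 \<partial>M) = (\<Sum>m<k. \<Sum>n<k. measure M (E m \<inter> E n))" for k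
    unfolding N2
    by (subst Bochner_Integration.integral_sum,
        (auto intro!: Bochner_Integration.integrable_sum sum.cong simp: emeasure_eq_measure)[1])
       (rule sum.cong[OF refl], subst Bochner_Integration.integral_sum, auto simp: emeasure_eq_measure)
  have lower: "1 / (2 * K) \<le> measure M (H a)" for a
  proof -
    define L where "L = measure M (space M)"
    \<comment> \<open>The value 1 makes \<open>second_moment\<close> applicable. The other value
      keeps \<open>real a * L\<close> below a quarter of \<open>s k\<close>, which leaves a bound on
      \<open>H a\<close> that does not depend on \<open>a\<close>.\<close>
    obtain k where k: "s k > max 1 (4 * real a * L)"
      using unb by blast
    then have s: "s k > 1" "4 * real a * L < s k" by auto
    define t where "t = 1 / (K * s k)"
    have t: "t > 0" using K s by (simp add: t_def)
    have pw: "N k x \<le> real a + (t * (N k x)\<^sup>2 + indicator (H a) x / t) / 2" if "x \<in> space M" for x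
    proof (cases "N k x > real a")
      case True
      then have "x \<in> H a" using that unfolding H_def by auto
      moreover have "2 * N k x \<le> t * (N k x)\<^sup>2 + 1 / t"
      proof -
        have "0 \<le> (t * N k x - 1)\<^sup>2 / t" using t by simp
        also have "\<dots> = t * (N k x)\<^sup>2 + 1 / t - 2 * N k x"
          using t by (simp add: power2_eq_square field_simps)
        finally show ?thesis by simp
      qed
      ultimately show ?thesis by (simp add: field_simps)
    next
      case False
      moreover have "0 \<le> (t * (N k x)\<^sup>2 + indicator (H a) x / t) / 2"
        using t by (intro divide_nonneg_nonneg add_nonneg_nonneg mult_nonneg_nonneg) auto
      ultimately show ?thesis by linarith
    qed
    have iH: "integrable M (\<lambda>x. indicator (H a) x :: real)" by (simp add: emeasure_eq_measure)
    have "s k = (\<integral>x. N k x \<partial>M)" by (simp add: IN)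
    also have "\<dots> \<le> (\<integral>x. real a + (t * (N k x)\<^sup>2 + indicator (H a) x / t) / 2 \<partial>M)"
      using iN iN2 iH pw by (intro integral_mono) auto
    also have "\<dots> = real a * L + (t * (\<integral>x. (N k x)\<^sup>2 \<partial>M) + measure M (H a) / t) / 2"
      using iN2 iH by (simp add: L_def)
    also have "\<dots> \<le> real a * L + (t * (K * (s k)\<^sup>2) + measure M (H a) / t) / 2"
      using second_moment[of k] s t unfolding IN2 s_def by (auto intro!: mult_left_mono)
    also have "t * (K * (s k)\<^sup>2) = s k"
      using K s by (simp add: t_def power2_eq_square)
    also have "measure M (H a) / t = measure M (H a) * K * s k"
      by (simp add: t_def)
    finally have "s k \<le> real a * L + (s k + measure M (H a) * K * s k) / 2" .
    then have "s k / 2 \<le> s k / 4 + measure M (H a) * K * s k / 2"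
      using s(2) by (simp add: field_simps)
    then have "s k * (1 / 2) \<le> s k * (1/4 + measure M (H a) * K / 2)"
      by (simp add: algebra_simps)
    then have "1 / 2 \<le> 1 / 4 + measure M (H a) * K / 2"
      using s by (subst (asm) mult_le_cancel_left_pos) auto
    then show ?thesis using K by (simp add: field_simps)
  qed
  have "(\<lambda>a. measure M (H a)) \<longlonglongrightarrow> measure M (\<Inter>a. H a)"
  proof (rule finite_Lim_measure_decseq)
    show "decseq H"
      unfolding H_def decseq_def
      by (auto intro: le_less_trans simp: of_nat_mono elim!: less_le_trans[rotated] dest: le_less_trans[OF of_nat_mono])
  qed auto
  then have "1 / (2 * K) \<le> measure M (\<Inter>a. H a)"
    using lower by (intro LIMSEQ_le_const) auto
  moreover have "(\<Inter>a. H a) \<subseteq> {x \<in> space M. infinite {n. x \<in> E n}}"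
  proof safe
    fix x assume x: "x \<in> (\<Inter>a. H a)" and fin: "finite {n. x \<in> E n}"
    have "N k x \<le> real (card {n. x \<in> E n})" for k
    proof -
      have "N k x = real (card ({..<k} \<inter> {n. x \<in> E n}))"
        unfolding N_def indicator_def by (simp add: sum.If_cases)
      also have "\<dots> \<le> real (card {n. x \<in> E n})"
        using fin by (intro of_nat_mono card_mono) auto
      finally show ?thesis .
    qed
    then show False using x by (force simp: H_def not_less[symmetric])
  qed (auto simp: H_def)
  moreover have "{x \<in> space M. infinite {n. x \<in> E n}} \<in> sets M"
    unfolding infinite_nat_iff_unbounded by measurable
  ultimately have "1 / (2 * K) \<le> measure M {x \<in> space M. infinite {n. x \<in> E n}}"
    by (meson finite_measure_mono order_trans)
  moreover have "0 < 1 / (2 * K)" using K by simp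
  ultimately show ?thesis by linarith
qed

section \<open>Blocks\<close>

lemma powr_power_base:
  fixes b a :: real
  assumes "0 < b"
  shows "(1 / b ^ k) powr a = (inverse b powr a) ^ k"
  using assms by (induction k) (simp_all add: powr_mult powr_divide field_simps)

context expanding_system
begin

abbreviation "Bl \<equiv> blocks T P0"
abbreviation "bl \<equiv> block T P0"

definition X0 :: "'a set" where
  "X0 = (\<Inter>n. \<Union>(Bl n))"

lemma space_lam [simp]: "space lam = UNIV"
  using sets_eq_imp_space_eq[OF sets_lam] by simp

lemmas sets_lam_borel [simp, measurable_cong] = sets_lam

lemma measurable_funpow [measurable]: "T ^^ n \<in> borel_measurable borel"
  using measurable_T by (rule measurable_compose_n)

lemma funpow_Suc_image: "(T ^^ Suc n) ` A = (T ^^ n) ` (T ` A)"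
  by (metis funpow_Suc_right image_comp)

lemma vimage_funpow [measurable]: "A \<in> sets borel \<Longrightarrow> (T ^^ n) -` A \<in> sets borel"
  using measurable_sets[OF measurable_funpow, of A n] by simp

lemma vimage_T [measurable]: "A \<in> sets borel \<Longrightarrow> T -` A \<in> sets borel"
  using vimage_funpow[of A 1] by simp

lemma countable_P0: "countable P0"
  by (rule countable_disjoint_open_subsets)
     (use open_partition disjoint_partition in \<open>auto simp: pairwise_def disjnt_def\<close>)

lemma blocks_subset_partition: "S \<in> Bl n \<Longrightarrow> \<exists>P\<in>P0. S \<subseteq> P"
  by (cases n) auto

lemma blocks_Suc_iff:
  "S \<in> Bl (Suc n) \<longleftrightarrow> (\<exists>P\<in>P0. \<exists>Q\<in>Bl n. Q \<subseteq> T ` P \<and> S = P \<inter> T -` Q)"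
  by auto

lemma blocks_SucE:
  assumes "S \<in> Bl (Suc n)"
  obtains P Q where "P \<in> P0" "Q \<in> Bl n" "Q \<subseteq> T ` P" "S = P \<inter> T -` Q" "T ` S = Q" "S \<subseteq> P"
proof -
  from assms obtain P Q where *: "P \<in> P0" "Q \<in> Bl n" "Q \<subseteq> T ` P" "S = P \<inter> T -` Q"
    by (auto simp: blocks_Suc_iff)
  then have "T ` S = Q" by blast
  then show ?thesis using that[OF *(1-4)] *(4) by auto
qed

declare blocks.simps(2) [simp del]

lemma countable_blocks: "countable (Bl n)"
proof (induction n)
  case (Suc n)
  have "Bl (Suc n) \<subseteq> (\<lambda>(P, Q). P \<inter> T -` Q) ` (P0 \<times> Bl n)"
    by (auto simp: blocks_Suc_iff)
  then show ?case
    using Suc countable_P0 by (meson countable_SIGMA countable_image countable_subset)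
qed (simp add: countable_P0)

lemma blocks_borel [measurable]: "S \<in> Bl n \<Longrightarrow> S \<in> sets borel"
proof (induction n arbitrary: S)
  case 0
  then show ?case using open_partition by auto
next
  case (Suc n)
  then show ?case using open_partition by (auto simp: blocks_Suc_iff intro!: sets.Int)
qed

lemma Union_blocks_borel [measurable]: "\<Union>(Bl n) \<in> sets borel"
  using countable_blocks blocks_borel by (intro sets.countable_Union) auto

lemma blocks_unique:
  "S \<in> Bl n \<Longrightarrow> S' \<in> Bl n \<Longrightarrow> x \<in> S \<Longrightarrow> x \<in> S' \<Longrightarrow> S = S'"
proof (induction n arbitrary: S S' x)
  case 0
  then show ?case using disjoint_partition by auto
next
  case (Suc n)
  from Suc.prems obtain P Q P' Q' where
    "P \<in> P0" "Q \<in> Bl n" "S = P \<inter> T -` Q" "P' \<in> P0" "Q' \<in> Bl n" "S' = P' \<inter> T -` Q'"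
    by (auto simp: blocks_Suc_iff)
  moreover from this Suc.prems have "P = P'" using disjoint_partition by auto
  ultimately show ?case using Suc.IH[of Q Q' "T x"] Suc.prems by auto
qed

text \<open>Inductively, \<open>T\<close> maps a block onto a block one level lower. That the image
  is a whole cell, not a part of one, is what later turns distortion into estimates for
  preimages.\<close>

lemma blocks_image: "S \<in> Bl n \<Longrightarrow> (T ^^ n) ` S \<in> P0"
proof (induction n arbitrary: S)
  case (Suc n)
  then obtain Q where "Q \<in> Bl n" "T ` S = Q" by (auto elim: blocks_SucE)
  then show ?case using Suc.IH[of Q] by (simp add: funpow_Suc_image del: funpow.simps)
qed simp

lemma blocks_nonempty: "S \<in> Bl n \<Longrightarrow> S \<noteq> {}"
  using blocks_image[of S n] positive_partition by auto

lemma blocks_in_image: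
  assumes "S \<in> Bl n" "P \<in> P0" "S \<inter> T ` P \<noteq> {}"
  shows "S \<subseteq> T ` P"
  using assms blocks_subset_partition[of S n] markov by blast

text \<open>The Markov condition is essential: the coarser block \<open>Q'\<close> around
  \<open>Q\<close> meets the image of \<open>P\<close>, hence lies inside it, so its pullback to
  \<open>P\<close> is again a block.\<close>

lemma blocks_refine: "S \<in> Bl (Suc n) \<Longrightarrow> \<exists>S'\<in>Bl n. S \<subseteq> S'"
proof (induction n arbitrary: S)
  case 0
  then show ?case using blocks_subset_partition by auto
next
  case (Suc n)
  then obtain P Q where PQ: "P \<in> P0" "Q \<in> Bl (Suc n)" "Q \<subseteq> T ` P" "S = P \<inter> T -` Q"
    by (auto simp: blocks_Suc_iff[of _ "Suc n"])
  from Suc.IH[OF PQ(2)] obtain Q' where Q': "Q' \<in> Bl n" "Q \<subseteq> Q'" by blast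
  have sub: "Q' \<subseteq> T ` P"
    using blocks_in_image[OF Q'(1) PQ(1)] blocks_nonempty[OF PQ(2)] PQ(3) Q'(2) by blast
  have "P \<inter> T -` Q' \<in> Bl (Suc n)"
    unfolding blocks_Suc_iff by (rule bexI, rule bexI, rule conjI, rule sub, rule refl, rule Q', rule PQ)
  moreover have "S \<subseteq> P \<inter> T -` Q'" unfolding PQ(4) using Q'(2) by auto
  ultimately show ?case by (rule bexI[rotated])
qed

lemma blocks_refine_add: "S \<in> Bl (n + k) \<Longrightarrow> \<exists>S'\<in>Bl n. S \<subseteq> S'"
proof (induction k arbitrary: S)
  case (Suc k)
  then obtain S' where S': "S' \<in> Bl (n + k)" "S \<subseteq> S'" using blocks_refine[of S "n + k"] by auto
  from Suc.IH[OF S'(1)] S'(2) show ?case by blast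
qed auto

lemma blocks_nested:
  assumes "S \<in> Bl m" "S' \<in> Bl n" "m \<le> n" "S \<inter> S' \<noteq> {}"
  shows "S' \<subseteq> S"
proof -
  obtain S'' where S'': "S'' \<in> Bl m" "S' \<subseteq> S''"
  proof -
    have "S' \<in> Bl (m + (n - m))" using assms(2,3) by simp
    then show ?thesis using blocks_refine_add that by blast
  qed
  obtain x where x: "x \<in> S" "x \<in> S'" using assms(4) by blast
  have "S = S''" using S'' x assms(1) by (intro blocks_unique[of S m S'' x]) auto
  then show ?thesis using S'' by simp
qed

lemma block_eqI: "S \<in> Bl n \<Longrightarrow> x \<in> S \<Longrightarrow> bl n x = S"
  unfolding block_def using blocks_unique by (intro the_equality) auto

lemma block_blocks: "x \<in> \<Union>(Bl n) \<Longrightarrow> bl n x \<in> Bl n"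
  and block_contains: "x \<in> \<Union>(Bl n) \<Longrightarrow> x \<in> bl n x"
  using block_eqI by auto

lemma X0_Union_blocks: "x \<in> X0 \<Longrightarrow> x \<in> \<Union>(Bl n)"
  by (auto simp: X0_def)

lemmas X0_block = block_blocks[OF X0_Union_blocks]
  and X0_mem_block = block_contains[OF X0_Union_blocks]

lemma X0_T: "x \<in> X0 \<Longrightarrow> T x \<in> X0"
proof -
  assume x: "x \<in> X0"
  have "T x \<in> \<Union>(Bl n)" for n
    using X0_Union_blocks[OF x, of "Suc n"] by (auto simp: blocks_Suc_iff)
  then show ?thesis by (auto simp: X0_def)
qed

lemma X0_funpow: "x \<in> X0 \<Longrightarrow> (T ^^ n) x \<in> X0"
  by (induction n) (auto intro: X0_T)

lemma block_antimono:
  assumes "x \<in> X0" "m \<le> n"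
  shows "bl n x \<subseteq> bl m x"
  by (rule blocks_nested[OF X0_block X0_block]) (use assms X0_mem_block[of x] in auto)

lemma T_image_block_Suc: "x \<in> X0 \<Longrightarrow> T ` bl (Suc n) x = bl n (T x)"
proof -
  assume x: "x \<in> X0"
  from X0_block[OF x, of "Suc n"] obtain Q where "Q \<in> Bl n" "T ` bl (Suc n) x = Q"
    by (auto elim: blocks_SucE)
  then show ?thesis using X0_mem_block[OF x, of "Suc n"] block_eqI[of Q n "T x"] by auto
qed

lemma funpow_image_block: "x \<in> X0 \<Longrightarrow> (T ^^ k) ` bl (n + k) x = bl n ((T ^^ k) x)"
proof (induction k arbitrary: x)
  case (Suc k)
  have "(T ^^ Suc k) ` bl (n + Suc k) x = (T ^^ k) ` (T ` bl (Suc (n + k)) x)"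
    by (simp add: funpow_Suc_image del: funpow.simps)
  also have "\<dots> = bl n ((T ^^ Suc k) x)"
    using Suc by (simp add: T_image_block_Suc X0_T funpow_Suc_right del: funpow.simps)
  finally show ?case .
qed simp

text \<open>Expansion read backwards: \<open>T ^^ n\<close> maps the block onto a cell, and cells
  have bounded diameter. Taking \<open>max D 1\<close> keeps the constant positive.\<close>

lemma block_diameter_bound:
  obtains C \<beta> :: real where "0 < C" "1 < \<beta>"
    "\<And>n S x y. S \<in> Bl n \<Longrightarrow> x \<in> S \<Longrightarrow> y \<in> S \<Longrightarrow> dist x y \<le> C / \<beta> ^ n"
proof -
  obtain D where D: "\<And>P. P \<in> P0 \<Longrightarrow> bounded P \<and> diameter P \<le> D"
    using diameter_partition by blast
  obtain \<beta> C2 :: real where E: "1 < \<beta>" "0 < C2"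
    "\<And>n P x y. P \<in> Bl n \<Longrightarrow> x \<in> P \<Longrightarrow> y \<in> P \<Longrightarrow>
       C2 * \<beta> ^ n * dist x y \<le> dist ((T ^^ n) x) ((T ^^ n) y)"
    using expansion
  proof (elim exE conjE)
    fix \<beta> C2 :: real
    assume *: "1 < \<beta>" "0 < C2" "\<forall>n. \<forall>P\<in>Bl n. \<forall>x\<in>P. \<forall>y\<in>P.
      C2 * \<beta> ^ n * dist x y \<le> dist ((T ^^ n) x) ((T ^^ n) y)"
    show thesis by (rule that[OF *(1,2)]) (use *(3) in simp)
  qed
  have "dist x y \<le> (max D 1 / C2) / \<beta> ^ n" if "S \<in> Bl n" "x \<in> S" "y \<in> S" for n S x y
  proof -
    have "C2 * \<beta> ^ n * dist x y \<le> dist ((T ^^ n) x) ((T ^^ n) y)" using E that by blast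
    also have "\<dots> \<le> diameter ((T ^^ n) ` S)"
      using D[OF blocks_image] that by (intro diameter_bounded_bound) auto
    also have "\<dots> \<le> max D 1" using D[OF blocks_image] that by (meson max.coboundedI1)
    finally have "dist x y * (C2 * \<beta> ^ n) \<le> max D 1" by (simp add: mult.commute)
    moreover have "0 < C2 * \<beta> ^ n" using E by simp
    ultimately show ?thesis by (simp add: pos_le_divide_eq del: max.bounded_iff)
  qed
  moreover have "0 < max D 1 / C2" using E by simp
  ultimately show ?thesis using that[OF _ E(1)] by blast
qed

lemma image_borel: "P \<in> P0 \<Longrightarrow> A \<in> sets borel \<Longrightarrow> A \<subseteq> P \<Longrightarrow> T ` A \<in> sets borel"
  using jacobian by blast

lemma jacobianE:
  obtains J :: "'a \<Rightarrow> real" and \<alpha> C :: real where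
    "J \<in> borel_measurable borel" "\<And>x. x \<in> \<Union>P0 \<Longrightarrow> 0 < J x"
    "\<And>P A. P \<in> P0 \<Longrightarrow> A \<in> sets borel \<Longrightarrow> A \<subseteq> P \<Longrightarrow>
       emeasure lam (T ` A) = (\<integral>\<^sup>+ x\<in>A. ennreal (J x) \<partial>lam)"
    "0 < \<alpha>" "0 < C"
    "\<And>P x y. P \<in> P0 \<Longrightarrow> x \<in> P \<Longrightarrow> y \<in> P \<Longrightarrow> \<bar>J x / J y - 1\<bar> \<le> C * dist (T x) (T y) powr \<alpha>"
  using jacobian
proof (elim exE conjE)
  fix J :: "'a \<Rightarrow> real" and \<alpha> C1 :: real
  assume *: "J \<in> borel_measurable borel" "\<forall>x\<in>\<Union>P0. 0 < J x"
    "\<forall>P\<in>P0. \<forall>A\<in>sets borel. A \<subseteq> P \<longrightarrow> T ` A \<in> sets borel \<and>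
       emeasure lam (T ` A) = (\<integral>\<^sup>+ x\<in>A. ennreal (J x) \<partial>lam)"
    "0 < \<alpha>" "0 < C1"
    "\<forall>P\<in>P0. \<forall>x\<in>P. \<forall>y\<in>P. \<bar>J x / J y - 1\<bar> \<le> C1 * dist (T x) (T y) powr \<alpha>"
  show thesis
    by (rule that[of J \<alpha> C1, OF *(1) bspec[OF *(2)] _ *(4,5)]) (use *(3,6) in simp_all)
qed

text \<open>Positivity of the Jacobian on the cells gives both directions. One makes
  \<open>T\<close> nonsingular (\<open>vimage_null\<close>), the other gives every block positive
  measure.\<close>

lemma image_null_iff:
  assumes "P \<in> P0" "A \<in> sets borel" "A \<subseteq> P"
  shows "emeasure lam (T ` A) = 0 \<longleftrightarrow> emeasure lam A = 0"
proof -
  obtain J :: "'a \<Rightarrow> real" where J: "J \<in> borel_measurable borel" "\<And>x. x \<in> \<Union>P0 \<Longrightarrow> 0 < J x"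
    "emeasure lam (T ` A) = (\<integral>\<^sup>+ x\<in>A. ennreal (J x) \<partial>lam)"
    by (rule jacobianE) (use assms in simp)
  have [measurable]: "J \<in> borel_measurable borel" "A \<in> sets borel" by fact+
  have "emeasure lam (T ` A) = 0 \<longleftrightarrow> (AE x in lam. ennreal (J x) * indicator A x = 0)"
    unfolding J(3) by (rule nn_integral_0_iff_AE) measurable
  also have "\<dots> \<longleftrightarrow> (AE x in lam. x \<notin> A)"
  proof (rule AE_cong)
    fix x show "(ennreal (J x) * indicator A x = 0) = (x \<notin> A)"
    proof (cases "x \<in> A")
      case True
      then have "0 < J x" using assms J(2) by auto
      then show ?thesis using True by auto
    qed simp
  qed
  also have "\<dots> \<longleftrightarrow> emeasure lam A = 0"
    using assms(2) by (subst AE_iff_measurable[of A]) auto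
  finally show ?thesis .
qed

lemma vimage_null:
  assumes N: "N \<in> sets borel" "emeasure lam N = 0"
  shows "emeasure lam (T -` N) = 0"
proof -
  have *: "emeasure lam (P \<inter> T -` N) = 0" if P: "P \<in> P0" for P
  proof -
    have "P \<inter> T -` N \<in> sets borel" using N P open_partition by auto
    moreover have "emeasure lam (T ` (P \<inter> T -` N)) = 0"
      by (rule emeasure_eq_0[OF _ N(2)]) (use N in auto)
    ultimately show ?thesis using image_null_iff[OF P, of "P \<inter> T -` N"] by auto
  qed
  have 1: "UNIV - \<Union>P0 \<in> null_sets lam"
    using null_partition Union_blocks_borel[of 0] by (intro null_setsI) auto
  have 2: "(\<Union>P\<in>P0. P \<inter> T -` N) \<in> null_sets lam"
  proof (rule null_sets_UN'[OF countable_P0])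
    fix P assume "P \<in> P0"
    then show "P \<inter> T -` N \<in> null_sets lam"
      using * N open_partition by (intro null_setsI) auto
  qed
  have "T -` N \<in> null_sets lam"
    by (rule null_sets_subset[OF null_sets.Un[OF 1 2]]) (use N in auto)
  then show ?thesis by auto
qed

text \<open>A point in no level-\<open>Suc n\<close> block either lies off the cells or is mapped to
  a point in no level-\<open>n\<close> block; nonsingularity then carries the induction.\<close>

lemma Union_blocks_conull: "emeasure lam (UNIV - \<Union>(Bl n)) = 0"
proof (induction n)
  case 0
  then show ?case using null_partition by simp
next
  case (Suc n)
  have "x \<in> (UNIV - \<Union>P0) \<union> T -` (UNIV - \<Union>(Bl n))" if "x \<notin> \<Union>(Bl (Suc n))" for x
  proof (rule ccontr)
    assume "\<not> ?thesis"
    then obtain P Q where "P \<in> P0" "x \<in> P" "Q \<in> Bl n" "T x \<in> Q" by auto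
    moreover from this have "Q \<subseteq> T ` P" using blocks_in_image by blast
    ultimately have "x \<in> P \<inter> T -` Q" "P \<inter> T -` Q \<in> Bl (Suc n)"
      unfolding blocks_Suc_iff by auto
    then show False using that by blast
  qed
  then have sub: "UNIV - \<Union>(Bl (Suc n)) \<subseteq> (UNIV - \<Union>(Bl 0)) \<union> T -` (UNIV - \<Union>(Bl n))" by fastforce
  have 1: "UNIV - \<Union>(Bl 0) \<in> null_sets lam"
    using null_partition Union_blocks_borel[of 0] by (intro null_setsI) auto
  have 2: "T -` (UNIV - \<Union>(Bl n)) \<in> null_sets lam"
    using vimage_null[OF _ Suc] Union_blocks_borel[of n] by (intro null_setsI) auto
  have "UNIV - \<Union>(Bl (Suc n)) \<in> null_sets lam"
    using null_sets_subset[OF null_sets.Un[OF 1 2] _ sub] Union_blocks_borel[of "Suc n"] by simp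
  then show ?case by auto
qed

lemma AE_X0: "AE x in lam. x \<in> X0"
proof -
  have "AE x in lam. x \<in> \<Union>(Bl n)" for n
    using Union_blocks_conull[of n] Union_blocks_borel[of n]
    by (subst AE_iff_measurable[of "UNIV - \<Union>(Bl n)"]) auto
  then have "AE x in lam. \<forall>n. x \<in> \<Union>(Bl n)" by (simp add: AE_all_countable)
  then show ?thesis by (simp add: X0_def)
qed

lemma blocks_positive: "S \<in> Bl n \<Longrightarrow> 0 < measure lam S"
proof -
  have "S \<in> Bl n \<Longrightarrow> emeasure lam S \<noteq> 0" for n
  proof (induction n arbitrary: S)
    case 0
    then show ?case using positive_partition by auto
  next
    case (Suc n)
    then obtain P Q where "P \<in> P0" "S \<subseteq> P" "Q \<in> Bl n" "T ` S = Q" by (auto elim: blocks_SucE)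
    then show ?case using Suc.IH[of Q] Suc.prems image_null_iff[of P S] blocks_borel[of S "Suc n"] by auto
  qed
  then show "S \<in> Bl n \<Longrightarrow> 0 < measure lam S"
    by (simp add: emeasure_eq_measure zero_less_measure_iff)
qed

end

section \<open>Bounded distortion\<close>

context expanding_system
begin

text \<open>Both \<open>A\<close> and \<open>B\<close> are compared with the value of
  \<open>J\<close> at one reference point of \<open>S\<close>; each comparison costs a factor
  \<open>c\<close>, whence the square.\<close>

lemma distortion_step:
  fixes J :: "'a \<Rightarrow> real"
  assumes P: "P \<in> P0" "S \<subseteq> P"
    and J [measurable]: "J \<in> borel_measurable borel" and J_pos: "\<And>x. x \<in> \<Union>P0 \<Longrightarrow> 0 < J x"
    and J_int: "\<And>P A. P \<in> P0 \<Longrightarrow> A \<in> sets borel \<Longrightarrow> A \<subseteq> P \<Longrightarrow>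
       emeasure lam (T ` A) = (\<integral>\<^sup>+ x\<in>A. ennreal (J x) \<partial>lam)"
    and c: "0 \<le> c" and J_le: "\<And>x y. x \<in> S \<Longrightarrow> y \<in> S \<Longrightarrow> J x \<le> c * J y"
    and A: "A \<in> sets borel" "A \<subseteq> S" and B: "B \<in> sets borel" "B \<subseteq> S"
  shows "measure lam (T ` A) * measure lam B \<le> c\<^sup>2 * measure lam (T ` B) * measure lam A"
proof (cases "S = {}")
  case True
  then show ?thesis using A B by simp
next
  case False
  then obtain y where y: "y \<in> S" by auto
  have Jy: "0 < J y" using y P J_pos by auto
  have [measurable]: "A \<in> sets borel" "B \<in> sets borel" using A B by auto
  have "emeasure lam (T ` A) = (\<integral>\<^sup>+ x\<in>A. ennreal (J x) \<partial>lam)"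
    using A P by (intro J_int[OF P(1)]) auto
  also have "\<dots> \<le> (\<integral>\<^sup>+ x\<in>A. ennreal (c * J y) \<partial>lam)"
    using A y by (intro nn_integral_mono) (auto split: split_indicator intro!: ennreal_leI J_le)
  also have "\<dots> = ennreal (c * J y) * emeasure lam A"
    by (subst nn_integral_cmult_indicator) auto
  finally have 1: "measure lam (T ` A) \<le> c * J y * measure lam A"
    using c Jy by (simp add: emeasure_eq_measure ennreal_mult[symmetric])
  have "ennreal (J y) * emeasure lam B = (\<integral>\<^sup>+ x\<in>B. ennreal (J y) \<partial>lam)"
    by (subst nn_integral_cmult_indicator) auto
  also have "\<dots> \<le> (\<integral>\<^sup>+ x. ennreal c * (ennreal (J x) * indicator B x) \<partial>lam)"
    using B y c P J_pos[of _] by (intro nn_integral_mono)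
      (auto split: split_indicator intro!: ennreal_leI J_le simp: ennreal_mult'[symmetric])
  also have "\<dots> = ennreal c * emeasure lam (T ` B)"
    using B P by (subst J_int[of P B]) (auto intro!: nn_integral_cmult)
  finally have 2: "J y * measure lam B \<le> c * measure lam (T ` B)"
    using c Jy by (simp add: emeasure_eq_measure ennreal_mult[symmetric])
  have "measure lam (T ` A) * measure lam B \<le> (c * J y * measure lam A) * measure lam B"
    using 1 by (intro mult_right_mono) auto
  also have "\<dots> = (c * measure lam A) * (J y * measure lam B)" by simp
  also have "\<dots> \<le> (c * measure lam A) * (c * measure lam (T ` B))"
    using 2 c by (intro mult_left_mono) auto
  finally show ?thesis by (simp add: power2_eq_square algebra_simps)
qed

text \<open>The cross-multiplied form avoids quotients by null sets. The constants of the successive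
  steps multiply to a convergent product because the Hoelder errors of the Jacobian are summable
  along contracting blocks.\<close>

lemma bounded_distortion_aux:
  "\<exists>K\<ge>1. \<forall>n. \<forall>S\<in>Bl n. \<forall>A\<in>sets borel. \<forall>B\<in>sets borel. A \<subseteq> S \<longrightarrow> B \<subseteq> S \<longrightarrow>
     measure lam ((T ^^ n) ` A) * measure lam B \<le> K * measure lam ((T ^^ n) ` B) * measure lam A"
proof -
  obtain J :: "'a \<Rightarrow> real" and \<alpha> C1 :: real where J: "J \<in> borel_measurable borel" "\<And>x. x \<in> \<Union>P0 \<Longrightarrow> 0 < J x"
    "\<And>P A. P \<in> P0 \<Longrightarrow> A \<in> sets borel \<Longrightarrow> A \<subseteq> P \<Longrightarrow>
       emeasure lam (T ` A) = (\<integral>\<^sup>+ x\<in>A. ennreal (J x) \<partial>lam)"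
    "0 < \<alpha>" "0 < C1"
    "\<And>P x y. P \<in> P0 \<Longrightarrow> x \<in> P \<Longrightarrow> y \<in> P \<Longrightarrow> \<bar>J x / J y - 1\<bar> \<le> C1 * dist (T x) (T y) powr \<alpha>"
    by (rule jacobianE) blast
  obtain C \<beta> :: real where C: "0 < C" "1 < \<beta>"
    "\<And>n S x y. S \<in> Bl n \<Longrightarrow> x \<in> S \<Longrightarrow> y \<in> S \<Longrightarrow> dist x y \<le> C / \<beta> ^ n"
    by (rule block_diameter_bound) blast
  \<comment> \<open>The relative variation of \<open>J\<close> on a level-\<open>Suc k\<close>
    block: its image under \<open>T\<close> is a level-\<open>k\<close> block, of diameter at most
    \<open>C / \<beta> ^ k\<close>.\<close>
  define q where "q k = C1 * (C / \<beta> ^ k) powr \<alpha>" for k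
  define K where "K n = (\<Prod>k<n. (1 + q k)\<^sup>2)" for n
  have q0: "0 \<le> q k" for k using J(5) by (simp add: q_def)
  have K0: "0 \<le> K n" for n unfolding K_def by (intro prod_nonneg) auto
  have main: "S \<in> Bl n \<Longrightarrow> A \<in> sets borel \<Longrightarrow> B \<in> sets borel \<Longrightarrow> A \<subseteq> S \<Longrightarrow> B \<subseteq> S \<Longrightarrow>
     measure lam ((T ^^ n) ` A) * measure lam B \<le> K n * measure lam ((T ^^ n) ` B) * measure lam A"
    for S n A B
  proof (induction n arbitrary: S A B)
    case 0
    then show ?case by (simp add: K_def)
  next
    case (Suc n)
    from Suc.prems(1) obtain P Q where PQ: "P \<in> P0" "Q \<in> Bl n" "T ` S = Q" "S \<subseteq> P"
      by (auto elim: blocks_SucE)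
    define a b where "a = measure lam (T ` A)" and "b = measure lam (T ` B)"
    define a' b' where "a' = measure lam ((T ^^ n) ` (T ` A))" and "b' = measure lam ((T ^^ n) ` (T ` B))"
    have TA: "T ` A \<in> sets borel" "T ` B \<in> sets borel"
      using image_borel[OF PQ(1)] Suc.prems PQ(4) by auto
    have IH: "a' * b \<le> K n * b' * a"
      unfolding a_def b_def a'_def b'_def
      using Suc.prems PQ(3) by (intro Suc.IH[OF PQ(2)] TA) auto
    have step: "a * measure lam B \<le> (1 + q n)\<^sup>2 * b * measure lam A"
      unfolding a_def b_def
    proof (rule distortion_step[OF PQ(1,4) J(1,2,3) _ _ Suc.prems(2,4,3,5)])
      fix x y assume xy: "x \<in> S" "y \<in> S"
      have Jy: "0 < J y" using xy PQ J(2) by auto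
      have xyP: "x \<in> P" "y \<in> P" using xy PQ(4) by auto
      have "J x / J y \<le> 1 + C1 * dist (T x) (T y) powr \<alpha>"
        using J(6)[OF PQ(1) xyP] by (simp add: abs_le_iff)
      also have "dist (T x) (T y) \<le> C / \<beta> ^ n"
        using xy PQ(3) by (intro C(3)[OF PQ(2)]) auto
      then have "1 + C1 * dist (T x) (T y) powr \<alpha> \<le> 1 + q n"
        unfolding q_def using J(4,5) by (intro add_left_mono mult_left_mono powr_mono2) auto
      finally show "J x \<le> (1 + q n) * J y" using Jy by (simp add: pos_divide_le_eq)
    qed (use q0[of n] in auto)
    have "a' * measure lam B \<le> K (Suc n) * b' * measure lam A"
    \<comment> \<open>The chain below ends by cancelling \<open>b\<close>; if \<open>b\<close>
      vanishes, then \<open>B\<close> is null by \<open>image_null_iff\<close> and the left side is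
      0.\<close>
    proof (cases "b = 0")
      case True
      then have "emeasure lam (T ` B) = 0" by (simp add: emeasure_eq_measure b_def)
      then have "measure lam B = 0"
        using image_null_iff[OF PQ(1), of B] Suc.prems PQ(4) by (auto simp: measure_def)
      then show ?thesis using K0 by (simp add: b'_def)
    next
      case False
      then have b: "b > 0" by (simp add: b_def zero_less_measure_iff)
      have "(a' * measure lam B) * b = (a' * b) * measure lam B" by simp
      also have "\<dots> \<le> (K n * b' * a) * measure lam B"
        using IH by (intro mult_right_mono) auto
      also have "\<dots> = (K n * b') * (a * measure lam B)" by simp
      also have "\<dots> \<le> (K n * b') * ((1 + q n)\<^sup>2 * b * measure lam A)"
        using step K0[of n] by (intro mult_left_mono) (auto simp: b'_def)
      also have "\<dots> = (K (Suc n) * b' * measure lam A) * b"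
        by (simp add: K_def algebra_simps)
      finally show ?thesis using b by simp
    qed
    then show ?case by (simp add: a'_def b'_def funpow_Suc_image del: funpow.simps)
  qed
  have sq: "summable q"
  proof -
    have "q = (\<lambda>k. C1 * C powr \<alpha> * (inverse \<beta> powr \<alpha>) ^ k)"
    proof
      fix k
      have "(C / \<beta> ^ k) powr \<alpha> = C powr \<alpha> * (1 / \<beta> ^ k) powr \<alpha>"
        using C by (subst powr_mult[symmetric]) auto
      then show "q k = C1 * C powr \<alpha> * (inverse \<beta> powr \<alpha>) ^ k"
        using C by (simp add: q_def powr_power_base)
    qed
    moreover have "inverse \<beta> powr \<alpha> < 1"
      using C J(4) powr_less_mono2[of \<alpha> "inverse \<beta>" 1] by (simp add: inverse_less_1_iff)
    ultimately show ?thesis by (auto intro!: summable_mult summable_geometric)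
  qed
  have Kb: "K n \<le> exp (2 * suminf q)" for n
  proof -
    have "K n \<le> (\<Prod>k<n. exp (2 * q k))"
      unfolding K_def
    proof (rule prod_mono)
      fix k
      have "(1 + q k)\<^sup>2 \<le> (exp (q k))\<^sup>2"
        using q0[of k] exp_ge_add_one_self[of "q k"] by (intro power_mono) auto
      then show "0 \<le> (1 + q k)\<^sup>2 \<and> (1 + q k)\<^sup>2 \<le> exp (2 * q k)"
        by (simp add: exp_double)
    qed
    also have "\<dots> = exp (2 * (\<Sum>k<n. q k))"
      by (simp add: exp_sum sum_distrib_left)
    also have "\<dots> \<le> exp (2 * suminf q)"
      using sum_le_suminf[OF sq, of "{..<n}"] q0 by simp
    finally show ?thesis .
  qed
  show ?thesis
  proof (intro exI[of _ "exp (2 * suminf q)"] conjI allI ballI impI)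
    show "1 \<le> exp (2 * suminf q)" using suminf_nonneg[OF sq] q0 by simp
    fix n S A B assume *: "S \<in> Bl n" "A \<in> sets borel" "B \<in> sets borel" "A \<subseteq> S" "B \<subseteq> S"
    have "measure lam ((T ^^ n) ` A) * measure lam B \<le> K n * (measure lam ((T ^^ n) ` B) * measure lam A)"
      using main[OF *] by (simp add: mult.assoc)
    also have "\<dots> \<le> exp (2 * suminf q) * (measure lam ((T ^^ n) ` B) * measure lam A)"
      by (intro mult_right_mono Kb) auto
    finally show "measure lam ((T ^^ n) ` A) * measure lam B \<le>
        exp (2 * suminf q) * measure lam ((T ^^ n) ` B) * measure lam A"
      by (simp add: mult.assoc)
  qed
qed

definition distortion :: real where
  "distortion = (SOME K. K \<ge> 1 \<and>
     (\<forall>n. \<forall>S\<in>Bl n. \<forall>A\<in>sets borel. \<forall>B\<in>sets borel. A \<subseteq> S \<longrightarrow> B \<subseteq> S \<longrightarrow>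
     measure lam ((T ^^ n) ` A) * measure lam B \<le> K * measure lam ((T ^^ n) ` B) * measure lam A))"

lemma distortion_ge_1: "1 \<le> distortion"
  and bounded_distortion: "S \<in> Bl n \<Longrightarrow> A \<in> sets borel \<Longrightarrow> B \<in> sets borel \<Longrightarrow> A \<subseteq> S \<Longrightarrow> B \<subseteq> S \<Longrightarrow>
     measure lam ((T ^^ n) ` A) * measure lam B \<le> distortion * measure lam ((T ^^ n) ` B) * measure lam A"
  using someI_ex[OF bounded_distortion_aux] unfolding distortion_def[symmetric] by auto

lemma distortion_pos: "0 < distortion"
  using distortion_ge_1 by linarith

text \<open>Bounded distortion applied to \<open>S\<close> and the part of \<open>S\<close> mapped
  into \<open>B\<close>: the share of that part in \<open>S\<close> is comparable to the share of
  \<open>B\<close> in the cell onto which \<open>S\<close> is mapped.\<close>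

lemma block_pullback:
  assumes S: "S \<in> Bl n" and B: "B \<in> sets borel"
  shows "measure lam (S \<inter> (T ^^ n) -` B) * measure lam ((T ^^ n) ` S)
      \<le> distortion * (measure lam S * measure lam ((T ^^ n) ` S \<inter> B))" (is ?upper)
    and "measure lam S * measure lam ((T ^^ n) ` S \<inter> B)
      \<le> distortion * (measure lam (S \<inter> (T ^^ n) -` B) * measure lam ((T ^^ n) ` S))" (is ?lower)
proof -
  have im: "(T ^^ n) ` (S \<inter> (T ^^ n) -` B) = (T ^^ n) ` S \<inter> B" by auto
  have m: "S \<inter> (T ^^ n) -` B \<in> sets borel" "S \<in> sets borel" using S B by auto
  show ?upper
    using bounded_distortion[OF S m(2,1)] unfolding im by (auto simp: algebra_simps)
  show ?lower
    using bounded_distortion[OF S m] unfolding im by (auto simp: algebra_simps)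
qed

lemma emeasure_blocks:
  assumes Y: "Y \<in> sets borel"
  shows "emeasure lam Y = (\<integral>\<^sup>+S. emeasure lam (Y \<inter> S) \<partial>count_space (Bl n))"
proof -
  have "UNIV - \<Union>(Bl n) \<in> null_sets lam"
    using Union_blocks_conull[of n] Union_blocks_borel[of n] by (intro null_setsI) auto
  then have "AE x in lam. x \<in> \<Union>(Bl n)"
    by (rule AE_I') auto
  then have "emeasure lam Y = emeasure lam (\<Union>S\<in>Bl n. Y \<inter> S)"
    using Y Union_blocks_borel[of n]
    by (intro emeasure_eq_AE) (auto simp: Int_Union[symmetric] intro!: sets.Int)
  also have "\<dots> = (\<integral>\<^sup>+S. emeasure lam (Y \<inter> S) \<partial>count_space (Bl n))"
  proof (rule emeasure_UN_countable[OF _ countable_blocks])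
    show "disjoint_family_on (\<lambda>S. Y \<inter> S) (Bl n)"
      unfolding disjoint_family_on_def using blocks_unique by blast
  qed (use Y in auto)
  finally show ?thesis .
qed

text \<open>Up to the null set of points in no level-\<open>n\<close> block, such a set is a union
  of level-\<open>n\<close> blocks. It plays the part of an event determined by the first
  \<open>n\<close> steps.\<close>

definition saturated :: "nat \<Rightarrow> 'a set \<Rightarrow> bool" where
  "saturated n V \<longleftrightarrow> V \<in> sets borel \<and> (\<forall>S\<in>Bl n. S \<inter> V = {} \<or> S \<subseteq> V)"

lemma saturated_block: "S \<in> Bl m \<Longrightarrow> m \<le> n \<Longrightarrow> saturated n S"
  unfolding saturated_def using blocks_nested[of S m _ n] by (auto simp: Int_commute)

lemma saturated_UNIV: "saturated n UNIV"
  by (simp add: saturated_def)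

lemma saturated_measure_mono:
  assumes V: "saturated n V" and A: "A \<in> sets borel" and B: "B \<in> sets borel" and c: "0 \<le> c"
    and le: "\<And>S. S \<in> Bl n \<Longrightarrow> S \<subseteq> V \<Longrightarrow> measure lam (S \<inter> A) \<le> c * measure lam (S \<inter> B)"
  shows "measure lam (V \<inter> A) \<le> c * measure lam (V \<inter> B)"
proof -
  have V': "V \<in> sets borel" using V by (simp add: saturated_def)
  have "emeasure lam (V \<inter> A) = (\<integral>\<^sup>+S. emeasure lam (V \<inter> A \<inter> S) \<partial>count_space (Bl n))"
    using V' A by (intro emeasure_blocks) auto
  also have "\<dots> \<le> (\<integral>\<^sup>+S. ennreal c * emeasure lam (V \<inter> B \<inter> S) \<partial>count_space (Bl n))"
  proof (rule nn_integral_mono)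
    fix S assume "S \<in> space (count_space (Bl n))"
    then have S: "S \<in> Bl n" by simp
    show "emeasure lam (V \<inter> A \<inter> S) \<le> ennreal c * emeasure lam (V \<inter> B \<inter> S)"
    proof (cases "S \<subseteq> V")
      case True
      then have "V \<inter> A \<inter> S = S \<inter> A" "V \<inter> B \<inter> S = S \<inter> B" by auto
      then show ?thesis using le[OF S True] c
        by (simp add: emeasure_eq_measure ennreal_mult[symmetric])
    next
      case False
      then have "V \<inter> A \<inter> S = {}" using V S by (auto simp: saturated_def)
      then show ?thesis by simp
    qed
  qed
  also have "\<dots> = ennreal c * emeasure lam (V \<inter> B)"
    using V' B by (subst emeasure_blocks[of "V \<inter> B" n]) (auto simp: nn_integral_cmult)
  finally show ?thesis using c by (simp add: emeasure_eq_measure ennreal_mult[symmetric])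
qed

text \<open>This is quasi-independence of past and future. Only blocks mapped exactly onto
  \<open>R\<close> meet the preimages involved, and \<open>block_pullback\<close> applies to each of
  them with the same constant.\<close>

lemma saturated_pullback:
  assumes V: "saturated n V" and R: "R \<in> P0" and B: "B \<in> sets borel" "B \<subseteq> R"
  shows "measure lam (V \<inter> (T ^^ n) -` B) * measure lam R
      \<le> distortion * (measure lam (V \<inter> (T ^^ n) -` R) * measure lam B)" (is ?upper)
    and "measure lam (V \<inter> (T ^^ n) -` R) * measure lam B
      \<le> distortion * (measure lam (V \<inter> (T ^^ n) -` B) * measure lam R)" (is ?lower)
proof -
  have R': "R \<in> sets borel" "0 < measure lam R"
    using blocks_borel[of R 0] blocks_positive[of R 0] R by auto
  have empty: "S \<inter> (T ^^ n) -` R = {}" "S \<inter> (T ^^ n) -` B = {}" if "S \<in> Bl n" "(T ^^ n) ` S \<noteq> R" for S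
  proof -
    have "(T ^^ n) ` S \<inter> R = {}"
      using blocks_image[OF that(1)] that(2) disjoint_partition R by simp
    then show "S \<inter> (T ^^ n) -` R = {}" "S \<inter> (T ^^ n) -` B = {}"
      using B(2) by auto
  qed
  have full: "S \<inter> (T ^^ n) -` R = S" if "(T ^^ n) ` S = R" for S
    using that by auto
  have inter: "R \<inter> B = B" using B by auto
  have "measure lam (V \<inter> (T ^^ n) -` B)
      \<le> (distortion * measure lam B / measure lam R) * measure lam (V \<inter> (T ^^ n) -` R)"
  proof (rule saturated_measure_mono[OF V])
    fix S assume S: "S \<in> Bl n"
    show "measure lam (S \<inter> (T ^^ n) -` B)
        \<le> distortion * measure lam B / measure lam R * measure lam (S \<inter> (T ^^ n) -` R)"
    proof (cases "(T ^^ n) ` S = R")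
      case True
      show ?thesis using block_pullback(1)[OF S B(1)] R'(2)
        unfolding full[OF True] True inter by (simp add: field_simps)
    qed (simp add: empty[OF S])
  qed (use R' B distortion_pos in auto)
  then show ?upper using R'(2) by (simp add: field_simps)
  show ?lower
  proof (cases "measure lam B = 0")
    case True
    then show ?thesis using distortion_pos by simp
  next
    case False
    then have B0: "0 < measure lam B" by (simp add: zero_less_measure_iff)
    have "measure lam (V \<inter> (T ^^ n) -` R)
        \<le> (distortion * measure lam R / measure lam B) * measure lam (V \<inter> (T ^^ n) -` B)"
    proof (rule saturated_measure_mono[OF V])
      fix S assume S: "S \<in> Bl n"
      show "measure lam (S \<inter> (T ^^ n) -` R)
          \<le> distortion * measure lam R / measure lam B * measure lam (S \<inter> (T ^^ n) -` B)"
      proof (cases "(T ^^ n) ` S = R")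
        case True
        show ?thesis using block_pullback(2)[OF S B(1)] B0
          unfolding full[OF True] True inter by (simp add: field_simps)
      qed (simp add: empty[OF S])
    qed (use R' B distortion_pos in auto)
    then show ?thesis using B0 by (simp add: field_simps)
  qed
qed

end

section \<open>Recurrence and ergodicity\<close>

context expanding_system
begin

lemma block_subset_open:
  assumes x: "x \<in> X0" and U: "open U" "x \<in> U"
  shows "\<forall>\<^sub>F n in sequentially. bl n x \<subseteq> U"
proof -
  obtain C \<beta> :: real where C: "0 < C" "1 < \<beta>"
    "\<And>n S x y. S \<in> Bl n \<Longrightarrow> x \<in> S \<Longrightarrow> y \<in> S \<Longrightarrow> dist x y \<le> C / \<beta> ^ n"
    by (rule block_diameter_bound) blast
  obtain e where e: "0 < e" "ball x e \<subseteq> U" using U open_contains_ball by blast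
  have "(\<lambda>n. C / \<beta> ^ n) \<longlonglongrightarrow> 0"
    using C(2) by (rule LIMSEQ_divide_realpow_zero)
  then have "\<forall>\<^sub>F n in sequentially. C / \<beta> ^ n < e"
    using e(1) by (rule order_tendstoD)
  then show ?thesis
  proof eventually_elim
    case (elim n)
    have "bl n x \<subseteq> ball x e"
      using C(3)[OF X0_block[OF x] X0_mem_block[OF x]] elim by force
    then show ?case using e(2) by blast
  qed
qed

lemma block_image_eq:
  assumes "x \<in> S" "S \<in> Bl n" "Q \<in> P0" "(T ^^ n) x \<in> Q"
  shows "(T ^^ n) ` S = Q"
proof -
  have "(T ^^ n) x \<in> (T ^^ n) ` S \<inter> Q" using assms by auto
  then show ?thesis using blocks_image[OF assms(2)] disjoint_partition assms(3) by (metis empty_iff)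
qed

lemma positive_cell:
  assumes F: "F \<in> sets borel" and pos: "0 < measure lam F"
  shows "\<exists>Q\<in>P0. 0 < measure lam (F \<inter> Q)"
proof (rule ccontr)
  assume "\<not> ?thesis"
  then have *: "F \<inter> Q \<in> null_sets lam" if "Q \<in> P0" for Q
    using that blocks_borel[of Q 0] F
    by (intro null_setsI) (auto simp: zero_less_measure_iff emeasure_eq_measure)
  have "(\<Union>Q\<in>P0. F \<inter> Q) \<in> null_sets lam"
    using * countable_P0 by (intro null_sets_UN') auto
  then have "AE x in lam. x \<notin> (\<Union>Q\<in>P0. F \<inter> Q)" by (rule AE_not_in)
  with AE_X0 have "AE x in lam. x \<notin> F"
  proof eventually_elim
    case (elim x)
    then show ?case using X0_Union_blocks[of x 0] by auto
  qed
  then show False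
    using pos F by (subst (asm) AE_iff_measurable[of F]) (auto simp: measure_def)
qed

text \<open>
  A density argument: almost all of \<open>F \<inter> Q\<close> is covered by disjoint blocks that are mapped onto \<open>Q\<close>
  and lie in an open set barely larger than \<open>F \<inter> Q\<close>. By bounded distortion each of them would contain
  a fixed proportion of \<open>- F\<close> if \<open>Q - F\<close> had positive measure.
\<close>

lemma returning_density:
  assumes F: "F \<in> sets borel" and inv: "\<And>n. measure lam (F \<inter> (T ^^ n) -` (- F)) = 0"
    and Q: "Q \<in> P0" and pos: "0 < measure lam (F \<inter> Q)"
    and ret: "AE x in lam. x \<in> F \<inter> Q \<longrightarrow> (\<exists>\<^sub>\<infinity>n. (T ^^ n) x \<in> Q)"
  shows "measure lam (Q - F) = 0"
proof (rule ccontr)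
  assume nz: "measure lam (Q - F) \<noteq> 0"
  have Q': "Q \<in> sets borel" "0 < measure lam Q"
    using blocks_borel[of Q 0] blocks_positive[of Q 0] Q by auto
  \<comment> \<open>The share of its measure that each block mapped onto \<open>Q\<close> must have
    outside \<open>F\<close>, as shown in \<open>ending\<close>.\<close>
  define \<kappa> where "\<kappa> = measure lam (Q - F) / (distortion * measure lam Q)"
  have \<kappa>: "0 < \<kappa>"
    using nz Q' distortion_pos by (simp add: \<kappa>_def zero_less_measure_iff)
  have ending: "\<kappa> * measure lam S \<le> measure lam (S - F)" if S: "S \<in> Bl n" "(T ^^ n) ` S = Q" for S n
  proof -
    have [simp]: "S \<in> sets borel" using S by auto
    have "measure lam S * measure lam (Q \<inter> - F)
        \<le> distortion * (measure lam (S \<inter> (T ^^ n) -` (- F)) * measure lam Q)"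
      using block_pullback(2)[OF S(1), of "- F"] F S(2) by auto
    moreover have "measure lam (S \<inter> (T ^^ n) -` (- F)) \<le> measure lam (S - F)"
    proof -
      have "measure lam (S \<inter> (T ^^ n) -` (- F)) \<le> measure lam ((S - F) \<union> (F \<inter> (T ^^ n) -` (- F)))"
        using F by (intro finite_measure_mono) (auto intro!: sets.Int sets.Un vimage_funpow)
      also have "\<dots> \<le> measure lam (S - F) + measure lam (F \<inter> (T ^^ n) -` (- F))"
        using F by (intro measure_Un_le) (auto intro!: sets.Int vimage_funpow)
      finally show ?thesis using inv by simp
    qed
    ultimately have "measure lam S * measure lam (Q \<inter> - F)
        \<le> distortion * (measure lam (S - F) * measure lam Q)"
      using distortion_pos by (smt (verit) measure_nonneg mult_left_mono mult_right_mono)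
    moreover have "Q \<inter> - F = Q - F" by auto
    ultimately show ?thesis
      using distortion_pos Q'(2) by (simp add: \<kappa>_def field_simps)
  qed
  have FQ: "F \<inter> Q \<in> sets borel" using F Q' by auto
  obtain U where U: "open U" "F \<inter> Q \<subseteq> U" "measure lam (U - F \<inter> Q) < \<kappa> * measure lam (F \<inter> Q)"
    by (rule borel_outer_approx[OF finite_measure_axioms sets_lam FQ mult_pos_pos[OF \<kappa> pos]])
  define good where "good n S \<longleftrightarrow> S \<in> Bl n \<and> S \<subseteq> U \<and> (T ^^ n) ` S = Q" for n S
  \<comment> \<open>Good blocks inside no good block of a lower level. As blocks are nested or
    disjoint, these are pairwise disjoint and still cover everything that good blocks cover.\<close>
  define \<D> where "\<D> n = {S. good n S \<and> \<not> (\<exists>i<n. \<exists>S'. good i S' \<and> S \<subseteq> S')}" for n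
  define D where "D n = \<Union>(\<D> n)" for n
  have \<D>B: "\<D> n \<subseteq> Bl n" for n by (auto simp: \<D>_def good_def)
  have DB [simp]: "D n \<in> sets borel" for n
    unfolding D_def using \<D>B[of n] countable_blocks[of n] countable_subset
    by (intro sets.countable_Union) auto
  have Dsub: "S \<in> \<D> n" if S: "S \<in> Bl n" "S \<inter> D n \<noteq> {}" for S n
  proof -
    obtain x S' where x: "x \<in> S" "x \<in> S'" "S' \<in> \<D> n" using S(2) unfolding D_def by blast
    then have "S = S'" using \<D>B[of n] S(1) by (intro blocks_unique[of S n S' x]) auto
    then show ?thesis using x by simp
  qed
  have sat: "saturated n (D n)" for n
    unfolding saturated_def
  proof (intro conjI ballI DB)
    fix S assume "S \<in> Bl n"
    then show "S \<inter> D n = {} \<or> S \<subseteq> D n"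
      using Dsub[of S n] by (cases "S \<inter> D n = {}") (auto simp: D_def)
  qed
  have disj: "disjoint_family D"
  proof -
    have "D i \<inter> D n = {}" if "i < n" for i n
    proof (rule ccontr)
      assume "D i \<inter> D n \<noteq> {}"
      then obtain S S' x where S: "S' \<in> \<D> i" "S \<in> \<D> n" "x \<in> S" "x \<in> S'"
        unfolding D_def by blast
      then have "S \<subseteq> S'"
        using \<D>B[of i] \<D>B[of n] that by (intro blocks_nested[of S' i S n]) auto
      then show False using S that unfolding \<D>_def by blast
    qed
    then show ?thesis
      unfolding disjoint_family_on_def by (metis Int_commute linorder_neqE_nat)
  qed
  have Dle: "\<kappa> * measure lam (D n) \<le> measure lam (D n - F)" for n
  proof -
    have "measure lam (D n \<inter> UNIV) \<le> (1 / \<kappa>) * measure lam (D n \<inter> - F)"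
    proof (rule saturated_measure_mono[OF sat])
      fix S assume S: "S \<in> Bl n" "S \<subseteq> D n"
      then have "good n S" using Dsub[of S n] blocks_nonempty[of S n] by (auto simp: \<D>_def)
      then show "measure lam (S \<inter> UNIV) \<le> (1 / \<kappa>) * measure lam (S \<inter> - F)"
        using ending[of S n] \<kappa> by (simp add: good_def field_simps Diff_eq)
    qed (use F \<kappa> in auto)
    then show ?thesis using \<kappa> by (simp add: field_simps Diff_eq)
  qed
  have s1: "(\<lambda>n. measure lam (D n)) sums measure lam (\<Union>n. D n)"
    using disj by (intro finite_measure_UNION) auto
  have s2: "(\<lambda>n. measure lam (D n - F)) sums measure lam (\<Union>n. D n - F)"
    using disj F by (intro finite_measure_UNION) (auto simp: disjoint_family_on_def)
  have "\<kappa> * measure lam (\<Union>n. D n) \<le> measure lam (\<Union>n. D n - F)"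
    by (rule sums_le[OF Dle sums_mult[OF s1] s2])
  also have "\<dots> \<le> measure lam (U - F \<inter> Q)"
    using U(1) FQ by (intro finite_measure_mono) (auto simp: D_def \<D>_def good_def)
  also have "\<dots> < \<kappa> * measure lam (F \<inter> Q)" by (rule U(3))
  also have "measure lam (F \<inter> Q) \<le> measure lam (\<Union>n. D n)"
  proof (rule finite_measure_mono_AE)
    show "AE x in lam. x \<in> F \<inter> Q \<longrightarrow> x \<in> (\<Union>n. D n)"
      using ret AE_X0
    proof eventually_elim
      case (elim x)
      show ?case
      proof
        assume x: "x \<in> F \<inter> Q"
        have "\<exists>\<^sub>\<infinity>n. (T ^^ n) x \<in> Q" using elim x by blast
        moreover have "\<forall>\<^sub>F n in sequentially. bl n x \<subseteq> U"
          using elim x U by (intro block_subset_open) auto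
        ultimately have "\<exists>n. (T ^^ n) x \<in> Q \<and> bl n x \<subseteq> U"
          by (metis (mono_tags, lifting) cofinite_eq_sequentially frequently_eventually_frequently frequently_ex)
        then obtain n where n: "(T ^^ n) x \<in> Q" "bl n x \<subseteq> U" by blast
        have "good n (bl n x)"
          unfolding good_def
          using n X0_block[of x n] elim(2) block_image_eq[OF X0_mem_block X0_block Q, of x n] by simp
        then have "\<exists>k. good k (bl k x)" by blast
        then obtain k where k: "good k (bl k x)" and least: "\<And>i. i < k \<Longrightarrow> \<not> good i (bl i x)"
          unfolding exists_least_iff[of "\<lambda>k. good k (bl k x)"] by blast
        have "bl k x \<in> \<D> k"
        proof -
          have "\<not> good i S'" if "i < k" "bl k x \<subseteq> S'" for i S'
          proof
            assume g: "good i S'"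
            then have "bl i x = S'"
              using that X0_mem_block[of x k] elim(2) by (intro block_eqI) (auto simp: good_def)
            then show False using g least[OF that(1)] by simp
          qed
          then show ?thesis using k by (auto simp: \<D>_def)
        qed
        then show "x \<in> (\<Union>n. D n)"
          using X0_mem_block[of x k] elim(2) by (auto simp: D_def)
      qed
    qed
  qed auto
  then have "\<kappa> * measure lam (F \<inter> Q) \<le> \<kappa> * measure lam (\<Union>n. D n)"
    using \<kappa> by (intro mult_left_mono) auto
  finally show False by simp
qed

text \<open>The transitivity condition speaks of positive measure only. A point of \<open>X0\<close>
  in the intersection improves it: its level-\<open>n0\<close> block lies in \<open>Q\<close>, and
  the image of that block is a whole cell meeting \<open>P\<close>.\<close>

lemma blocks_covering:
  obtains n0 where "0 < n0"
    "\<And>P Q. P \<in> P0 \<Longrightarrow> Q \<in> P0 \<Longrightarrow> \<exists>S\<in>Bl n0. S \<subseteq> Q \<and> (T ^^ n0) ` S = P"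
proof -
  obtain n0 where n0: "n0 > 0"
    "\<forall>P\<in>P0. \<forall>Q\<in>P0. 0 < emeasure lam ((T ^^ n0) -` P \<inter> Q)"
    using transitive by blast
  have "\<exists>S\<in>Bl n0. S \<subseteq> Q \<and> (T ^^ n0) ` S = P" if P: "P \<in> P0" and Q: "Q \<in> P0" for P Q
  proof -
    have PQ: "P \<in> sets borel" "Q \<in> sets borel" using blocks_borel[of _ 0] P Q by auto
    have "emeasure lam ((T ^^ n0) -` P \<inter> Q) \<noteq> 0"
      using n0 P Q by force
    then have "\<not> (AE x in lam. x \<notin> (T ^^ n0) -` P \<inter> Q)"
      using PQ by (subst AE_iff_measurable[of "(T ^^ n0) -` P \<inter> Q"]) auto
    then obtain x where x: "x \<in> X0" "(T ^^ n0) x \<in> P" "x \<in> Q"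
      using AE_X0 by (metis (mono_tags, lifting) AE_mp AE_I2 IntD1 IntD2 vimageD)
    have b: "bl n0 x \<in> Bl n0" "x \<in> bl n0 x" using x X0_block X0_mem_block by auto
    have "bl n0 x \<subseteq> Q"
      using b x Q by (intro blocks_nested[of Q 0 "bl n0 x" n0]) auto
    moreover have "(T ^^ n0) ` bl n0 x = P"
      using b x P by (intro block_image_eq) auto
    ultimately show ?thesis using b by blast
  qed
  then show ?thesis using that n0(1) by blast
qed

text \<open>Once \<open>F\<close> fills one cell \<open>Q\<close>, blocks of \<open>Q\<close> that
  cover the other cells carry \<open>F\<close> to all of them. Recurrence is a hypothesis because
  the lemma is needed before \<open>mu\<close> and \<open>lam\<close> are known to be equivalent,
  when recurrence is available only where the density of \<open>mu\<close> is positive.\<close>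

lemma returning_conull:
  assumes F: "F \<in> sets borel" and inv: "\<And>n. measure lam (F \<inter> (T ^^ n) -` (- F)) = 0"
    and Q: "Q \<in> P0" and pos: "0 < measure lam (F \<inter> Q)"
    and ret: "AE x in lam. x \<in> F \<inter> Q \<longrightarrow> (\<exists>\<^sub>\<infinity>n. (T ^^ n) x \<in> Q)"
  shows "AE x in lam. x \<in> F"
proof -
  have QF: "measure lam (Q - F) = 0" by (rule returning_density) fact+
  obtain n0 where n0: "\<And>P Q. P \<in> P0 \<Longrightarrow> Q \<in> P0 \<Longrightarrow> \<exists>S\<in>Bl n0. S \<subseteq> Q \<and> (T ^^ n0) ` S = P"
    by (rule blocks_covering) blast
  have null: "P - F \<in> null_sets lam" if P: "P \<in> P0" for P
  proof -
    have PB: "P \<in> sets borel" "Q \<in> sets borel" using blocks_borel[of _ 0] P Q by auto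
    obtain S where S: "S \<in> Bl n0" "S \<subseteq> Q" "(T ^^ n0) ` S = P" using n0 P Q by blast
    have "measure lam (S \<inter> (T ^^ n0) -` (- F)) \<le> measure lam ((Q - F) \<union> (F \<inter> (T ^^ n0) -` (- F)))"
      using F S PB by (intro finite_measure_mono) (auto intro!: sets.Int sets.Un vimage_funpow)
    also have "\<dots> \<le> measure lam (Q - F) + measure lam (F \<inter> (T ^^ n0) -` (- F))"
      using F PB by (intro measure_Un_le) (auto intro!: sets.Int vimage_funpow)
    finally have "measure lam (S \<inter> (T ^^ n0) -` (- F)) = 0"
      using QF inv measure_nonneg by (metis add_0 dual_order.antisym)
    then have "measure lam S * measure lam (P \<inter> - F) \<le> 0"
      using block_pullback(2)[OF S(1), of "- F"] F S(3) by auto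
    then have "measure lam (P \<inter> - F) = 0"
      using blocks_positive[OF S(1)] by (smt (verit) measure_nonneg mult_pos_pos)
    then show ?thesis
      using F PB by (intro null_setsI) (auto simp: emeasure_eq_measure Diff_eq)
  qed
  have "(\<Union>P\<in>P0. P - F) \<in> null_sets lam"
    using null countable_P0 by (intro null_sets_UN') auto
  then have "AE x in lam. x \<notin> (\<Union>P\<in>P0. P - F)" by (rule AE_not_in)
  with AE_X0 show ?thesis
  proof eventually_elim
    case (elim x)
    then show ?case using X0_Union_blocks[of x 0] by auto
  qed
qed

end

section \<open>Equivalence of \<open>mu\<close> and \<open>lam\<close>, ergodicity, and preimages of
  cells\<close>

locale expanding_system_acipm = expanding_system lam T P0
  for lam :: "'a::{metric_space, second_countable_topology} measure" and T P0 +
  fixes mu :: "'a measure"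
  assumes acipm: "is_acipm lam T mu"
begin

sublocale mu: prob_space mu
  using acipm by (simp add: is_acipm_def)

lemma sets_mu [simp, measurable_cong]: "sets mu = sets borel"
  using acipm by (simp add: is_acipm_def)

lemma space_mu [simp]: "space mu = UNIV"
  using sets_eq_imp_space_eq[OF sets_mu] by simp

lemma mu_ac: "absolutely_continuous lam mu"
  using acipm by (simp add: is_acipm_def)

lemma emeasure_mu_vimage_funpow: "A \<in> sets borel \<Longrightarrow> emeasure mu ((T ^^ n) -` A) = emeasure mu A"
proof (induction n)
  case (Suc n)
  have "(T ^^ Suc n) -` A = T -` ((T ^^ n) -` A)" by (metis funpow_Suc_right vimage_comp)
  then show ?case using Suc acipm by (simp add: is_acipm_def del: funpow.simps)
qed simp

text \<open>The set \<open>G n\<close> of points that visit \<open>E\<close> at some time from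
  \<open>n\<close> on is the \<open>n\<close>-th preimage of \<open>G 0\<close>, hence has the same
  finite measure; being contained in \<open>G 0\<close>, it differs from it by a null set.\<close>

lemma poincare_recurrence:
  assumes E: "E \<in> sets borel"
  shows "AE x in mu. x \<in> E \<longrightarrow> (\<exists>\<^sub>\<infinity>n. (T ^^ n) x \<in> E)"
proof -
  define G where "G n = (\<Union>i\<in>{n..}. (T ^^ i) -` E)" for n
  have G [simp]: "G n \<in> sets borel" for n
    unfolding G_def using E by (intro sets.countable_UN') auto
  have G_eq: "emeasure mu (G n) = emeasure mu (G 0)" for n
  proof -
    have "G n = (T ^^ n) -` G 0"
      unfolding G_def
    proof (intro set_eqI iffI)
      fix x assume "x \<in> (\<Union>i\<in>{n..}. (T ^^ i) -` E)"
      then obtain i where "n \<le> i" "(T ^^ i) x \<in> E" by auto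
      then have "(T ^^ (i - n)) ((T ^^ n) x) \<in> E"
        by (metis comp_apply funpow_add le_add_diff_inverse2)
      then show "x \<in> (T ^^ n) -` (\<Union>i\<in>{0..}. (T ^^ i) -` E)" by auto
    next
      fix x assume "x \<in> (T ^^ n) -` (\<Union>i\<in>{0..}. (T ^^ i) -` E)"
      then obtain i where "(T ^^ i) ((T ^^ n) x) \<in> E" by auto
      then have "(T ^^ (i + n)) x \<in> E" by (simp add: funpow_add)
      then show "x \<in> (\<Union>i\<in>{n..}. (T ^^ i) -` E)" by (auto intro!: bexI[of _ "i + n"])
    qed
    then show ?thesis by (simp add: emeasure_mu_vimage_funpow)
  qed
  have "AE x in mu. x \<notin> G 0 - G n" for n
  proof (rule AE_not_in)
    have "emeasure mu (G 0 - G n) = emeasure mu (G 0) - emeasure mu (G n)"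
      by (rule emeasure_Diff) (simp_all, auto simp: G_def)
    then show "G 0 - G n \<in> null_sets mu"
      unfolding G_eq[of n] by (intro null_setsI) (auto simp: mu.emeasure_eq_measure ennreal_minus)
  qed
  then have "AE x in mu. \<forall>n. x \<notin> G 0 - G n" by (simp only: AE_all_countable) blast
  then show ?thesis
  proof eventually_elim
    case (elim x)
    show ?case
    proof
      assume "x \<in> E"
      then have "x \<in> G 0" unfolding G_def by (intro UN_I[of 0]) auto
      then have "\<forall>n. \<exists>i\<ge>n. (T ^^ i) x \<in> E" using elim by (auto simp: G_def)
      then show "\<exists>\<^sub>\<infinity>n. (T ^^ n) x \<in> E" by (simp add: INFM_nat_le)
    qed
  qed
qed

lemma mu_density:
  obtains f where "f \<in> borel_measurable lam" "density lam f = mu"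
proof -
  obtain f where "f \<in> borel_measurable lam" "density lam f = mu"
    using Radon_Nikodym[OF mu_ac] by auto
  then show ?thesis using that by blast
qed

text \<open>Let \<open>G\<close> be the set where the density is nonzero. Its complement is
  \<open>mu\<close>-null, so by invariance are the preimages of the complement, and inside
  \<open>G\<close> they are therefore \<open>lam\<close>-null. Thus \<open>G\<close> is forward
  invariant modulo \<open>lam\<close>, and \<open>returning_conull\<close> makes it conull.\<close>

lemma lam_ac: "absolutely_continuous mu lam"
proof -
  obtain f where f [measurable]: "f \<in> borel_measurable lam" and mu: "density lam f = mu"
    by (rule mu_density)
  define G where "G = {x. f x \<noteq> 0}"
  have G [measurable]: "G \<in> sets borel"
    using measurable_sets[of f lam borel "- {0}"] by (simp add: G_def vimage_def)
  have null: "A \<in> null_sets mu \<longleftrightarrow> A \<in> sets borel \<and> (AE x in lam. x \<in> A \<longrightarrow> f x = 0)" for A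
    unfolding mu[symmetric] by (subst null_sets_density_iff) auto
  have AE_G: "AE x in lam. x \<in> G \<longrightarrow> P x" if "AE x in mu. P x" for P
  proof -
    have "AE x in lam. 0 < f x \<longrightarrow> P x"
      using that unfolding mu[symmetric] by (subst (asm) AE_density) auto
    then show ?thesis by eventually_elim (auto simp: G_def zero_less_iff_neq_zero)
  qed
  have nG: "- G \<in> null_sets mu"
    by (subst null) (auto simp: G_def[symmetric] G Compl_in_sets_lebesgue, auto simp: G_def)
  have inv: "measure lam (G \<inter> (T ^^ n) -` (- G)) = 0" for n
  proof -
    have "emeasure mu ((T ^^ n) -` (- G)) = 0"
      using emeasure_mu_vimage_funpow[of "- G" n] nG G by auto
    then have "AE x in mu. x \<notin> (T ^^ n) -` (- G)"
      using G by (intro AE_not_in null_setsI) (auto intro!: vimage_funpow)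
    from AE_G[OF this] have "AE x in lam. x \<notin> G \<inter> (T ^^ n) -` (- G)" by eventually_elim auto
    then have "emeasure lam (G \<inter> (T ^^ n) -` (- G)) = 0"
      using G by (subst (asm) AE_iff_measurable[of "G \<inter> (T ^^ n) -` (- G)"])
        (auto intro!: sets.Int vimage_funpow)
    then show ?thesis by (simp add: measure_def)
  qed
  have "0 < measure lam G"
  proof (rule ccontr)
    assume "\<not> ?thesis"
    then have "G \<in> null_sets lam"
      using G by (intro null_setsI) (auto simp: zero_less_measure_iff emeasure_eq_measure)
    then have "AE x in lam. x \<notin> G" by (rule AE_not_in)
    then have "UNIV \<in> null_sets mu" by (subst null) (auto simp: G_def)
    then show False using mu.emeasure_space_1 by auto
  qed
  then obtain Q where Q: "Q \<in> P0" "0 < measure lam (G \<inter> Q)"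
    using positive_cell[OF G] by blast
  have "AE x in lam. x \<in> G"
  proof (rule returning_conull[OF G inv Q])
    have "AE x in lam. x \<in> G \<longrightarrow> x \<in> Q \<longrightarrow> (\<exists>\<^sub>\<infinity>n. (T ^^ n) x \<in> Q)"
      using blocks_borel[of Q 0] Q(1) by (intro AE_G poincare_recurrence) auto
    then show "AE x in lam. x \<in> G \<inter> Q \<longrightarrow> (\<exists>\<^sub>\<infinity>n. (T ^^ n) x \<in> Q)"
      by eventually_elim auto
  qed
  show ?thesis
    unfolding absolutely_continuous_def
  proof
    fix A assume A: "A \<in> null_sets mu"
    then have "AE x in lam. x \<in> A \<longrightarrow> f x = 0" using null by auto
    with \<open>AE x in lam. x \<in> G\<close> have "AE x in lam. x \<notin> A"
      by eventually_elim (auto simp: G_def)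
    then show "A \<in> null_sets lam"
      using A null by (subst (asm) AE_iff_null_sets[symmetric]) auto
  qed
qed

lemma AE_mu_imp_lam: "AE x in mu. P x \<Longrightarrow> AE x in lam. P x"
  by (rule absolutely_continuous_AE[OF _ lam_ac]) auto

lemma ergodic_forward_invariant:
  assumes F: "F \<in> sets borel" and inv: "\<And>x. x \<in> F \<Longrightarrow> T x \<in> F" and pos: "0 < measure lam F"
  shows "AE x in lam. x \<in> F"
proof -
  obtain Q where Q: "Q \<in> P0" "0 < measure lam (F \<inter> Q)"
    using positive_cell[OF F pos] by blast
  show ?thesis
  proof (rule returning_conull[OF F _ Q])
    have "(T ^^ n) x \<in> F" if "x \<in> F" for x n
      using that by (induction n) (auto intro: inv)
    then have "F \<inter> (T ^^ n) -` (- F) = {}" for n by auto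
    then show "measure lam (F \<inter> (T ^^ n) -` (- F)) = 0" for n by simp
    have "AE x in lam. x \<in> Q \<longrightarrow> (\<exists>\<^sub>\<infinity>n. (T ^^ n) x \<in> Q)"
      using blocks_borel[of Q 0] Q(1) by (intro AE_mu_imp_lam poincare_recurrence) auto
    then show "AE x in lam. x \<in> F \<inter> Q \<longrightarrow> (\<exists>\<^sub>\<infinity>n. (T ^^ n) x \<in> Q)"
      by eventually_elim auto
  qed
qed

text \<open>The preimages of \<open>R\<close> keep the \<open>mu\<close>-measure of
  \<open>R\<close>. Discarding the set where the density exceeds a large \<open>N\<close> costs less
  than half of it, and on the rest \<open>mu\<close> is at most \<open>N\<close> times
  \<open>lam\<close>.\<close>

lemma vimage_measure_lower_bound:
  assumes R: "R \<in> P0"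
  obtains c where "0 < c" "\<And>n. c \<le> measure lam ((T ^^ n) -` R)"
proof -
  obtain f where f [measurable]: "f \<in> borel_measurable lam" and mu: "density lam f = mu"
    by (rule mu_density)
  have RB [measurable]: "R \<in> sets borel" using blocks_borel[of R 0] R by simp
  have "R \<notin> null_sets mu"
    using lam_ac positive_partition R by (force simp: absolutely_continuous_def)
  then have muR: "0 < measure mu R"
    using RB by (auto simp: zero_less_measure_iff mu.emeasure_eq_measure null_sets_def)
  define H where "H N = {x. ennreal (real N) < f x}" for N
  have H [measurable]: "H N \<in> sets borel" for N
    using measurable_sets[of f lam borel "{ennreal (real N)<..}"] by (simp add: H_def vimage_def)
  have "(\<lambda>N. measure mu (H N)) \<longlonglongrightarrow> measure mu (\<Inter>N. H N)"
  proof (rule mu.finite_Lim_measure_decseq)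
    show "decseq H" unfolding H_def decseq_def
      by (auto intro: le_less_trans[rotated] ennreal_leI)
  qed (use H in auto)
  moreover have "measure mu (\<Inter>N. H N) = 0"
  proof -
    have "AE x in lam. f x \<noteq> \<infinity>"
    proof (rule nn_integral_PInf_AE)
      have "(\<integral>\<^sup>+ x. f x \<partial>lam) = emeasure mu UNIV"
        unfolding mu[symmetric] by (subst emeasure_density) auto
      then show "(\<integral>\<^sup>+ x. f x \<partial>lam) \<noteq> \<infinity>" by (simp add: mu.emeasure_eq_measure)
    qed auto
    then have "AE x in lam. x \<notin> (\<Inter>N. H N)"
    proof eventually_elim
      case (elim x)
      then obtain r where r: "f x = ennreal r" "0 \<le> r" by (cases "f x") auto
      obtain N where "r \<le> real N" using real_arch_simple by blast
      then have "x \<notin> H N" using r by (auto simp: H_def not_less ennreal_leI)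
      then show ?case by auto
    qed
    then have "AE x in mu. x \<notin> (\<Inter>N. H N)"
      by (intro absolutely_continuous_AE[OF _ mu_ac]) auto
    then have "emeasure mu (\<Inter>N. H N) = 0"
      by (subst (asm) AE_iff_measurable[of "\<Inter>N. H N"]) auto
    then show ?thesis by (simp add: measure_def)
  qed
  ultimately have "\<forall>\<^sub>F N in sequentially. measure mu (H N) < measure mu R / 2"
    using muR by (metis half_gt_zero order_tendstoD(2))
  then obtain N where N: "measure mu (H N) < measure mu R / 2"
    by (auto simp: eventually_sequentially)
  \<comment> \<open>\<open>Suc N\<close> instead of \<open>N\<close> permits the later division
    without excluding \<open>N = 0\<close>.\<close>
  have bound: "measure mu R / 2 \<le> real (Suc N) * measure lam ((T ^^ n) -` R)" for n
  proof -
    let ?A = "(T ^^ n) -` R"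
    have A [measurable]: "?A \<in> sets borel" using RB by (rule vimage_funpow)
    have "emeasure mu (?A - H N) = (\<integral>\<^sup>+ x. f x * indicator (?A - H N) x \<partial>lam)"
      unfolding mu[symmetric] by (subst emeasure_density) auto
    also have "\<dots> \<le> (\<integral>\<^sup>+ x. ennreal (real N) * indicator ?A x \<partial>lam)"
      by (intro nn_integral_mono) (auto simp: H_def split: split_indicator)
    also have "\<dots> = ennreal (real N) * emeasure lam ?A"
      by (rule nn_integral_cmult_indicator) auto
    finally have 1: "measure mu (?A - H N) \<le> real N * measure lam ?A"
      by (simp add: emeasure_eq_measure mu.emeasure_eq_measure ennreal_mult[symmetric])
    have "measure mu R = measure mu ?A"
      using emeasure_mu_vimage_funpow[OF RB, of n] by (simp add: measure_def)
    also have "\<dots> \<le> measure mu ((?A - H N) \<union> H N)"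
      by (intro mu.finite_measure_mono) auto
    also have "\<dots> \<le> measure mu (?A - H N) + measure mu (H N)"
      by (intro measure_Un_le) auto
    also have "\<dots> \<le> real N * measure lam ?A + measure mu R / 2" using 1 N by linarith
    finally have "measure mu R / 2 \<le> real N * measure lam ?A" by linarith
    also have "\<dots> \<le> real (Suc N) * measure lam ?A" by (intro mult_right_mono) auto
    finally show ?thesis .
  qed
  show ?thesis
  proof (rule that)
    show "0 < measure mu R / 2 / real (Suc N)" using muR by simp
    show "measure mu R / 2 / real (Suc N) \<le> measure lam ((T ^^ n) -` R)" for n
      using bound[of n] by (subst pos_divide_le_eq) (auto simp: mult.commute)
  qed
qed

end

section \<open>Hitting shrinking blocks\<close>

text \<open>This links the entropy, defined by \<open>infsum\<close>, to sums over cells written as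
  integrals over \<open>count_space\<close>; finiteness is all that is transferred, so one
  inequality suffices.\<close>

lemma nn_integral_count_space_le_infsum:
  fixes g :: "'b \<Rightarrow> ennreal"
  assumes A: "countable A"
  shows "(\<integral>\<^sup>+x. g x \<partial>count_space A) \<le> infsum g A"
proof (cases "finite A")
  case True
  then show ?thesis by (simp add: nn_integral_count_space_finite)
next
  case False
  define b where "b = from_nat_into A"
  have b: "bij_betw b UNIV A"
    unfolding b_def using A False by (rule bij_betw_from_nat_into)
  have "(\<integral>\<^sup>+x. g x \<partial>count_space A) = (\<Sum>n. g (b n))"
    using nn_integral_bij_count_space[OF b, of g] by (simp add: nn_integral_count_space_nat)
  also have "\<dots> = (SUP N. \<Sum>n<N. g (b n))"
    by (rule suminf_eq_SUP)
  also have "\<dots> \<le> infsum g A"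
  proof (rule SUP_least)
    fix N
    have "(\<Sum>n<N. g (b n)) = sum g (b ` {..<N})"
      using b by (subst sum.reindex) (auto simp: bij_betw_def inj_on_def)
    also have "\<dots> \<le> infsum g A"
      using b by (subst nonneg_infsum_complete) (auto simp: bij_betw_def intro!: SUP_upper)
    finally show "(\<Sum>n<N. g (b n)) \<le> infsum g A" .
  qed
  finally show ?thesis .
qed

text \<open>Both sides equal the sums of \<open>f\<close> below \<open>N\<close> and below
  \<open>j\<close> minus the sum below \<open>N + j\<close>. The right side has \<open>j\<close>
  terms only, which yields a bound independent of \<open>N\<close>.\<close>

lemma sum_shift_telescope:
  fixes f :: "nat \<Rightarrow> real"
  shows "(\<Sum>k<N. f k - f (j + k)) = (\<Sum>k<j. f k - f (N + k))"
proof (induction N)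
  case (Suc N)
  have "(\<Sum>k<j. f (N + k) - f (N + Suc k)) = f N - f (N + j)"
    using sum_lessThan_telescope'[of "\<lambda>k. f (N + k)" j] by simp
  moreover have "(\<Sum>k<j. f k - f (Suc N + k)) = (\<Sum>k<j. f k - f (N + k)) + (\<Sum>k<j. f (N + k) - f (N + Suc k))"
    by (simp add: sum.distrib[symmetric])
  ultimately show ?case using Suc by (simp add: add.commute)
qed simp

context expanding_system
begin

lemma measure_singleton: "measure lam {x} = 0"
proof (rule ccontr)
  assume "measure lam {x} \<noteq> 0"
  then have pos: "0 < emeasure lam {x}" by (simp add: emeasure_eq_measure zero_less_measure_iff)
  have "{x} \<in> sets lam" by simp
  then obtain B where B: "B \<subseteq> {x}" "0 < emeasure lam B" "emeasure lam B < emeasure lam {x}"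
    using nonatomic_lam pos unfolding nonatomic_def by blast
  then have "B = {} \<or> B = {x}" by blast
  then show False using B by auto
qed

text \<open>Non-atomicity enters here: the blocks around \<open>x\<close> decrease to a subset of
  \<open>{x}\<close>.\<close>

lemma block_measure_tendsto_0:
  assumes x: "x \<in> X0"
  shows "(\<lambda>n. measure lam (bl n x)) \<longlonglongrightarrow> 0"
proof -
  have "(\<lambda>n. measure lam (bl n x)) \<longlonglongrightarrow> measure lam (\<Inter>n. bl n x)"
    using blocks_borel[OF X0_block[OF x]] block_antimono[OF x]
    by (intro finite_Lim_measure_decseq) (auto simp: decseq_def)
  moreover have "(\<Inter>n. bl n x) \<subseteq> {x}"
  proof
    fix y assume y: "y \<in> (\<Inter>n. bl n x)"
    show "y \<in> {x}"
    proof (rule ccontr)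
      assume "y \<notin> {x}"
      then have "\<forall>\<^sub>F n in sequentially. bl n x \<subseteq> - {y}"
        using x by (intro block_subset_open) auto
      then show False using y by (auto simp: eventually_sequentially)
    qed
  qed
  then have "measure lam (\<Inter>n. bl n x) \<le> measure lam {x}"
    by (intro finite_measure_mono) auto
  ultimately show ?thesis using measure_singleton[of x] measure_nonneg[of lam "\<Inter>n. bl n x"] by simp
qed

text \<open>The error term, at lag \<open>k\<close>, in the correlation between a block around
  \<open>x\<close> and the preimage of another one; see \<open>block_return_bound\<close>.\<close>

definition return_measure :: "'a \<Rightarrow> nat \<Rightarrow> real" where
  "return_measure x k = (if (T ^^ k) x \<in> bl 0 x then measure lam (bl k x) else 0)"

lemma block_returned:
  assumes x: "x \<in> X0" and ret: "(T ^^ k) x \<in> bl 0 x"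
  shows "(T ^^ k) ` bl k x = bl 0 x"
  using x ret X0_block[OF x, of 0]
  by (intro block_image_eq[OF X0_mem_block[OF x] X0_block[OF x]]) auto

text \<open>
  Some level \<open>j\<close> genuinely splits \<open>bl 0 x\<close>. By bounded distortion every return of \<open>x\<close> to
  \<open>bl 0 x\<close> therefore costs a fixed proportion of the measure within \<open>j\<close> further steps, and the
  resulting losses telescope.
\<close>

lemma summable_return_measure:
  assumes x: "x \<in> X0"
  shows "summable (return_measure x)"
proof -
  define R where "R = bl 0 x"
  have RB: "R \<in> Bl 0" unfolding R_def by (rule X0_block[OF x])
  have Rpos: "0 < measure lam R" using blocks_positive[OF RB] .
  have "\<forall>\<^sub>F n in sequentially. measure lam (bl n x) < measure lam R"
    using block_measure_tendsto_0[OF x] Rpos by (rule order_tendstoD)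
  then obtain j where j: "measure lam (bl j x) < measure lam R"
    by (auto simp: eventually_sequentially)
  \<comment> \<open>A level-\<open>j\<close> block inside \<open>R\<close> is either
    \<open>bl j x\<close> or disjoint from it; the two terms bound what it leaves uncovered in each
    case.\<close>
  define \<eta> where "\<eta> = min (measure lam (bl j x)) (measure lam R - measure lam (bl j x))"
  have \<eta>: "0 < \<eta>" using j blocks_positive[OF X0_block[OF x, of j]] by (simp add: \<eta>_def)
  have jR: "bl j x \<subseteq> R" unfolding R_def by (rule block_antimono[OF x]) simp
  have miss: "\<eta> \<le> measure lam (R - S)" if S: "S \<in> Bl j" "S \<subseteq> R" for S
  proof (cases "S = bl j x")
    case True
    then show ?thesis
      using finite_measure_Diff[of R S] blocks_borel[OF RB] blocks_borel[OF S(1)] S(2)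
      by (simp add: \<eta>_def)
  next
    case False
    then have "bl j x \<inter> S = {}"
      using blocks_unique[OF X0_block[OF x, of j] S(1)] by blast
    then have "measure lam (bl j x) \<le> measure lam (R - S)"
      using jR blocks_borel[OF RB] blocks_borel[OF S(1)] by (intro finite_measure_mono) auto
    then show ?thesis by (simp add: \<eta>_def)
  qed
  define \<theta> where "\<theta> = \<eta> / (distortion * measure lam R)"
  have \<theta>: "0 < \<theta>" using \<eta> Rpos distortion_pos by (simp add: \<theta>_def)
  have loss: "\<theta> * return_measure x k \<le> measure lam (bl k x) - measure lam (bl (j + k) x)" for k
  proof (cases "(T ^^ k) x \<in> bl 0 x")
    case False
    then show ?thesis
      using finite_measure_mono[OF block_antimono[OF x, of k "j + k"]] blocks_borel[OF X0_block[OF x, of k]]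
      by (simp add: return_measure_def)
  next
    case True
    let ?S = "bl j ((T ^^ k) x)"
    have kR: "(T ^^ k) ` bl k x = R" unfolding R_def using block_returned[OF x True] .
    have Tx: "(T ^^ k) x \<in> X0" by (rule X0_funpow[OF x])
    have S: "?S \<in> Bl j" "(T ^^ k) ` bl (j + k) x = ?S"
      using X0_block[OF Tx] funpow_image_block[OF x] by auto
    have "?S \<subseteq> bl 0 ((T ^^ k) x)" by (rule block_antimono[OF Tx]) simp
    also have "bl 0 ((T ^^ k) x) = R"
      using True RB by (intro block_eqI) (auto simp: R_def)
    finally have SR: "?S \<subseteq> R" .
    have m: "bl k x \<in> sets borel" "bl (j + k) x \<in> sets borel" "R \<in> sets borel" "?S \<in> sets borel"
      using blocks_borel[OF X0_block[OF x]] blocks_borel[OF RB] blocks_borel[OF S(1)] by auto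
    have "measure lam (bl k x) * \<eta> \<le> measure lam (bl k x) * measure lam (R \<inter> (R - ?S))"
      using miss[OF S(1) SR] by (intro mult_left_mono) (auto simp: Int_absorb1)
    also have "\<dots> \<le> distortion * (measure lam (bl k x \<inter> (T ^^ k) -` (R - ?S)) * measure lam R)"
      using block_pullback(2)[OF X0_block[OF x, of k], of "R - ?S"] m kR by auto
    also have "\<dots> \<le> distortion * (measure lam (bl k x - bl (j + k) x) * measure lam R)"
      using m S(2) distortion_pos
      by (intro mult_left_mono mult_right_mono finite_measure_mono) auto
    also have "measure lam (bl k x - bl (j + k) x) = measure lam (bl k x) - measure lam (bl (j + k) x)"
      using m block_antimono[OF x, of k "j + k"] by (intro finite_measure_Diff) auto
    finally show ?thesis
      using True Rpos distortion_pos by (simp add: \<theta>_def return_measure_def field_simps)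
  qed
  show ?thesis
  proof (rule summableI_nonneg_bounded)
    show "0 \<le> return_measure x k" for k by (simp add: return_measure_def)
    fix N
    have "\<theta> * (\<Sum>k<N. return_measure x k) \<le> (\<Sum>k<N. measure lam (bl k x) - measure lam (bl (j + k) x))"
      unfolding sum_distrib_left by (intro sum_mono loss)
    also have "\<dots> = (\<Sum>k<j. measure lam (bl k x) - measure lam (bl (N + k) x))"
      by (rule sum_shift_telescope)
    also have "\<dots> \<le> (\<Sum>k<j. measure lam (bl k x))"
      by (intro sum_mono) auto
    finally show "(\<Sum>k<N. return_measure x k) \<le> (\<Sum>k<j. measure lam (bl k x)) / \<theta>"
      using \<theta> by (simp add: field_simps)
  qed
qed

text \<open>If \<open>p \<le> k\<close>, then \<open>bl p x\<close> is saturated at level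
  \<open>k\<close> and quasi-independence applies. Otherwise \<open>bl p x\<close> lies in
  \<open>bl k x\<close>, whose image is a whole cell: it is \<open>bl 0 x\<close>, and the pullback
  within \<open>bl k x\<close> bounds the overlap, or it is another cell, and the overlap is empty.
  The levels \<open>p\<close> and \<open>q\<close> are unrelated.\<close>

lemma block_return_bound:
  assumes x: "x \<in> X0"
  shows "measure lam (bl p x \<inter> (T ^^ k) -` bl q x) * measure lam (bl 0 x)
     \<le> distortion * (measure lam (bl q x) * (measure lam (bl p x) + return_measure x k))"
proof -
  have R: "bl 0 x \<in> P0" using X0_block[OF x, of 0] by simp
  have m: "bl i x \<in> sets borel" for i by (rule blocks_borel[OF X0_block[OF x]])
  have qR: "bl q x \<subseteq> bl 0 x" by (rule block_antimono[OF x]) simp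
  have rm: "0 \<le> return_measure x k" by (simp add: return_measure_def)
  show ?thesis
  proof (cases "p \<le> k")
    case True
    have "measure lam (bl p x \<inter> (T ^^ k) -` bl q x) * measure lam (bl 0 x)
        \<le> distortion * (measure lam (bl p x \<inter> (T ^^ k) -` bl 0 x) * measure lam (bl q x))"
      by (rule saturated_pullback(1)[OF saturated_block[OF X0_block[OF x] True] R m qR])
    also have "\<dots> \<le> distortion * (measure lam (bl p x) * measure lam (bl q x))"
      using distortion_pos m by (intro mult_left_mono mult_right_mono finite_measure_mono) auto
    also have "\<dots> \<le> distortion * (measure lam (bl q x) * (measure lam (bl p x) + return_measure x k))"
      using distortion_pos rm by (auto simp: algebra_simps)
    finally show ?thesis .
  next
    case False
    then have pk: "bl p x \<subseteq> bl k x" by (intro block_antimono[OF x]) simp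
    show ?thesis
    proof (cases "(T ^^ k) x \<in> bl 0 x")
      case True
      have "measure lam (bl p x \<inter> (T ^^ k) -` bl q x) * measure lam (bl 0 x)
         \<le> measure lam (bl k x \<inter> (T ^^ k) -` bl q x) * measure lam ((T ^^ k) ` bl k x)"
        unfolding block_returned[OF x True] using pk m
        by (intro mult_right_mono finite_measure_mono) (auto intro!: sets.Int vimage_funpow)
      also have "\<dots> \<le> distortion * (measure lam (bl k x) * measure lam ((T ^^ k) ` bl k x \<inter> bl q x))"
        by (rule block_pullback(1)[OF X0_block[OF x] m])
      also have "(T ^^ k) ` bl k x \<inter> bl q x = bl q x"
        unfolding block_returned[OF x True] using qR by auto
      also have "measure lam (bl k x) = return_measure x k"
        using True by (simp add: return_measure_def)
      also have "distortion * (return_measure x k * measure lam (bl q x))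
          \<le> distortion * (measure lam (bl q x) * (measure lam (bl p x) + return_measure x k))"
        using distortion_pos by (auto simp: algebra_simps)
      finally show ?thesis .
    next
      case noret: False
      have "(T ^^ k) ` bl k x \<in> P0" by (rule blocks_image[OF X0_block[OF x]])
      moreover have "(T ^^ k) ` bl k x \<noteq> bl 0 x"
        using noret X0_mem_block[OF x, of k] by blast
      ultimately have "(T ^^ k) ` bl k x \<inter> bl 0 x = {}"
        using disjoint_partition R by simp
      then have "bl p x \<inter> (T ^^ k) -` bl q x = {}" using pk qR by auto
      then show ?thesis using distortion_pos rm by (auto intro!: mult_nonneg_nonneg add_nonneg_nonneg)
    qed
  qed
qed

end

section \<open>Second moments and the passage from positive to full measure\<close>

context expanding_system_acipm
begin

text \<open>The measure of \<open>E n\<close> is bounded below by a multiple of \<open>b n\<close>.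
  For \<open>i \<le> n\<close> the overlap of \<open>E i\<close> and \<open>E n\<close> is a
  pullback of a correlation at lag \<open>n - i\<close>, which splits into a product term and a
  return term, as \<open>kochen_stone\<close> requires.\<close>

lemma block_limsup_positive:
  assumes x: "x \<in> X0" and div: "\<not> summable (\<lambda>n. measure lam (bl (N n) x))"
  shows "0 < measure lam {y. infinite {n. (T ^^ n) y \<in> bl (N n) x}}"
proof -
  define R where "R = bl 0 x"
  have R: "R \<in> P0" using X0_block[OF x, of 0] by (simp add: R_def)
  have m: "bl i x \<in> sets borel" for i by (rule blocks_borel[OF X0_block[OF x]])
  have RB: "R \<in> sets borel" unfolding R_def by (rule m)
  have Rpos: "0 < measure lam R" using blocks_positive[of R 0] R by simp
  have sub: "bl i x \<subseteq> R" for i unfolding R_def by (rule block_antimono[OF x]) simp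
  obtain c where c: "0 < c" "\<And>n. c \<le> measure lam ((T ^^ n) -` R)"
    by (rule vimage_measure_lower_bound[OF R]) blast
  define K L A where "K = distortion" and "L = measure lam UNIV" and "A = suminf (return_measure x)"
  have K: "0 < K" unfolding K_def by (rule distortion_pos)
  have L: "0 \<le> L" by (simp add: L_def)
  have rm: "0 \<le> return_measure x k" for k by (simp add: return_measure_def)
  have A: "0 \<le> A" unfolding A_def by (intro suminf_nonneg summable_return_measure x rm)
  define b where "b n = measure lam (bl (N n) x)" for n
  define E where "E n = (T ^^ n) -` bl (N n) x" for n
  have b0: "0 \<le> b n" for n by (simp add: b_def)
  have Em: "E n \<in> sets borel" for n unfolding E_def using m by simp
  define c' where "c' = c / (K * measure lam R)"
  have c': "0 < c'" using c K Rpos by (simp add: c'_def)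
  have lower: "c' * b n \<le> measure lam (E n)" for n
  proof -
    have "c * b n \<le> measure lam (UNIV \<inter> (T ^^ n) -` R) * b n"
      using c(2) b0 by (intro mult_right_mono) auto
    also have "\<dots> \<le> K * (measure lam (UNIV \<inter> E n) * measure lam R)"
      unfolding b_def E_def K_def by (rule saturated_pullback(2)[OF saturated_UNIV R m sub])
    finally show ?thesis using K Rpos by (simp add: c'_def field_simps)
  qed
  have upper: "measure lam ((T ^^ n) -` C) * measure lam R \<le> K * L * measure lam C"
    if C: "C \<in> sets borel" "C \<subseteq> R" for n C
  proof -
    have "measure lam (UNIV \<inter> (T ^^ n) -` C) * measure lam R
        \<le> K * (measure lam (UNIV \<inter> (T ^^ n) -` R) * measure lam C)"
      unfolding K_def by (rule saturated_pullback(1)[OF saturated_UNIV R C])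
    also have "\<dots> \<le> K * (L * measure lam C)"
      unfolding L_def using K by (intro mult_left_mono mult_right_mono finite_measure_mono) auto
    finally show ?thesis by (simp add: mult.assoc)
  qed
  define C2 where "C2 = K * K * L / (measure lam R * measure lam R)"
  have C2: "0 \<le> C2" using K L by (simp add: C2_def)
  have pair: "measure lam (E i \<inter> E n) \<le> C2 * (b n * (b i + return_measure x (n - i)))"
    if "i \<le> n" for i n
  proof -
    let ?C = "bl (N i) x \<inter> (T ^^ (n - i)) -` bl (N n) x"
    have C: "?C \<in> sets borel" "?C \<subseteq> R" using m sub by auto
    have "(T ^^ n) y = (T ^^ (n - i)) ((T ^^ i) y)" for y
      using that by (metis comp_apply funpow_add le_add_diff_inverse2)
    then have eq: "E i \<inter> E n = (T ^^ i) -` ?C" unfolding E_def by auto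
    have "measure lam (E i \<inter> E n) * measure lam R * measure lam R \<le> K * L * (measure lam ?C * measure lam R)"
      using mult_right_mono[OF upper[OF C, of i], of "measure lam R"] Rpos by (simp add: eq mult.assoc)
    also have "\<dots> \<le> K * L * (K * (b n * (b i + return_measure x (n - i))))"
      unfolding R_def b_def K_def using distortion_pos L
      by (intro mult_left_mono block_return_bound[OF x]) auto
    finally show ?thesis using Rpos by (simp add: C2_def field_simps)
  qed
  \<comment> \<open>For fixed \<open>n\<close> each lag \<open>n - i\<close> occurs at most once, so
    the return terms add only a multiple of the first moment.\<close>
  have ret_sum: "(\<Sum>i<k. if i \<le> n then return_measure x (n - i) else 0) \<le> A" for n k
  proof -
    have "(\<Sum>i<k. if i \<le> n then return_measure x (n - i) else 0)
        = (\<Sum>i\<in>{..<k} \<inter> {..n}. return_measure x (n - i))"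
      by (subst sum.inter_restrict) (auto intro!: sum.cong)
    also have "\<dots> \<le> (\<Sum>i\<le>n. return_measure x (n - i))"
      using rm by (intro sum_mono2) auto
    also have "\<dots> = (\<Sum>i\<le>n. return_measure x i)"
      using sum.nat_diff_reindex[of "return_measure x" "Suc n"]
      by (simp add: lessThan_Suc_atMost)
    also have "\<dots> \<le> A"
      unfolding A_def using summable_return_measure[OF x] rm by (intro sum_le_suminf) auto
    finally show ?thesis .
  qed
  have double: "(\<Sum>i<k. \<Sum>n<k. measure lam (E i \<inter> E n)) \<le> C2 * (\<Sum>n<k. b n)\<^sup>2 + 2 * C2 * A * (\<Sum>n<k. b n)" for k
  proof -
    \<comment> \<open>With \<open>g i n\<close> and \<open>g n i\<close> both orders of the pair are
      covered at once; counting the diagonal twice is harmless in an upper bound.\<close>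
    define g where "g i n = (if i \<le> n then return_measure x (n - i) else 0)" for i n
    have g0: "0 \<le> g i n" for i n by (simp add: g_def rm)
    have pw: "measure lam (E i \<inter> E n) \<le> C2 * (b i * b n + b n * g i n + b i * g n i)" for i n
    proof (cases "i \<le> n")
      case True
      have "measure lam (E i \<inter> E n) \<le> C2 * (b n * (b i + g i n))" using pair[OF True] True by (simp add: g_def)
      also have "\<dots> \<le> C2 * (b i * b n + b n * g i n + b i * g n i)"
        using C2 b0[of i] g0[of n i] by (intro mult_left_mono) (auto simp: algebra_simps)
      finally show ?thesis .
    next
      case False
      then have "n \<le> i" by simp
      have "measure lam (E i \<inter> E n) \<le> C2 * (b i * (b n + g n i))"
        using pair[OF \<open>n \<le> i\<close>] \<open>n \<le> i\<close> by (simp add: g_def Int_commute)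
      also have "\<dots> \<le> C2 * (b i * b n + b n * g i n + b i * g n i)"
        using C2 b0[of n] g0[of i n] by (intro mult_left_mono) (auto simp: algebra_simps)
      finally show ?thesis .
    qed
    have *: "(\<Sum>n<k. b n * (\<Sum>i<k. g i n)) \<le> (\<Sum>n<k. b n) * A"
      unfolding sum_distrib_right using ret_sum b0 by (intro sum_mono mult_left_mono) (auto simp: g_def)
    have "(\<Sum>i<k. \<Sum>n<k. measure lam (E i \<inter> E n))
        \<le> (\<Sum>i<k. \<Sum>n<k. C2 * (b i * b n + b n * g i n + b i * g n i))"
      by (intro sum_mono pw)
    also have "\<dots> = C2 * ((\<Sum>i<k. \<Sum>n<k. b i * b n) + (\<Sum>i<k. \<Sum>n<k. b n * g i n)
        + (\<Sum>i<k. \<Sum>n<k. b i * g n i))"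
      by (simp add: sum.distrib sum_distrib_left distrib_left)
    also have "(\<Sum>i<k. \<Sum>n<k. b i * b n) = (\<Sum>n<k. b n)\<^sup>2"
      by (simp add: power2_eq_square sum_product)
    also have "(\<Sum>i<k. \<Sum>n<k. b n * g i n) = (\<Sum>n<k. b n * (\<Sum>i<k. g i n))"
      by (subst sum.swap) (simp add: sum_distrib_left)
    also have "(\<Sum>i<k. \<Sum>n<k. b i * g n i) = (\<Sum>n<k. b n * (\<Sum>i<k. g i n))"
      by (simp add: sum_distrib_left)
    also have "C2 * ((\<Sum>n<k. b n)\<^sup>2 + (\<Sum>n<k. b n * (\<Sum>i<k. g i n)) + (\<Sum>n<k. b n * (\<Sum>i<k. g i n)))
        \<le> C2 * ((\<Sum>n<k. b n)\<^sup>2 + (\<Sum>n<k. b n) * A + (\<Sum>n<k. b n) * A)"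
      using * C2 by (intro mult_left_mono add_mono) auto
    finally show ?thesis by (simp add: algebra_simps)
  qed
  have "0 < measure lam {y \<in> space lam. infinite {n. y \<in> E n}}"
  proof (rule kochen_stone)
    show "E n \<in> sets lam" for n using Em by simp
    show "\<not> summable (\<lambda>n. measure lam (E n))"
    proof
      assume s: "summable (\<lambda>n. measure lam (E n))"
      have "summable (\<lambda>n. c' * b n)"
        by (rule summable_comparison_test'[OF s, of 0]) (use lower b0 c' in auto)
      then have "summable b" using c' by (simp add: summable_cmult_iff)
      then show False using div by (simp add: b_def[abs_def])
    qed
    \<comment> \<open>The first two summands come from \<open>s \<le> t / c'\<close>, the linear
      term being raised to a square by \<open>1 \<le> t\<close>. The final 1 secures positivity, as
      \<open>C2\<close> and \<open>A\<close> are only known to be nonnegative.\<close>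
    show "0 < C2 / (c' * c') + 2 * C2 * A / c' + 1"
      using C2 A c' by (intro add_nonneg_pos add_nonneg_nonneg divide_nonneg_pos mult_nonneg_nonneg) auto
    fix k assume ge: "1 \<le> (\<Sum>n<k. measure lam (E n))"
    define s t where "s = (\<Sum>n<k. b n)" and "t = (\<Sum>n<k. measure lam (E n))"
    have t: "1 \<le> t" using ge by (simp add: t_def)
    have s0: "0 \<le> s" unfolding s_def by (intro sum_nonneg b0)
    have "c' * s \<le> t" unfolding s_def t_def sum_distrib_left by (intro sum_mono lower)
    then have st: "s \<le> t / c'" using c' by (simp add: field_simps)
    have "(\<Sum>i<k. \<Sum>n<k. measure lam (E i \<inter> E n)) \<le> C2 * s\<^sup>2 + 2 * C2 * A * s"
      using double[of k] by (simp add: s_def)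
    also have "\<dots> \<le> C2 * (t / c')\<^sup>2 + 2 * C2 * A * (t / c')"
      using st s0 C2 A by (intro add_mono mult_left_mono power_mono) auto
    also have "\<dots> \<le> C2 * (t / c')\<^sup>2 + 2 * C2 * A * (t\<^sup>2 / c')"
      using t C2 A c' by (intro add_mono mult_left_mono divide_right_mono) (auto simp: power2_eq_square)
    also have "\<dots> \<le> (C2 / (c' * c') + 2 * C2 * A / c' + 1) * t\<^sup>2"
      by (simp add: power2_eq_square algebra_simps)
    finally show "(\<Sum>i<k. \<Sum>n<k. measure lam (E i \<inter> E n))
        \<le> (C2 / (c' * c') + 2 * C2 * A / c' + 1) * (\<Sum>n<k. measure lam (E n))\<^sup>2"
      by (simp add: t_def)
  qed
  then show ?thesis by (simp add: E_def)
qed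

text \<open>With arbitrary levels \<open>N n\<close> the limsup set of blocks need not be forward
  invariant; it only gives \<open>target_set\<close> positive measure. The latter is forward
  invariant: a hit of \<open>y\<close> at time \<open>Suc k\<close> is one of \<open>T y\<close> at
  time \<open>k\<close>, with a radius at least as large.\<close>

lemma AE_target_set:
  assumes x: "x \<in> X0" and div: "\<not> summable (\<lambda>n. measure lam (bl (N n) x))"
    and sub: "\<And>n. 1 \<le> n \<Longrightarrow> bl (N n) x \<subseteq> ball x (r n)"
    and mono: "\<And>m n. 1 \<le> m \<Longrightarrow> m \<le> n \<Longrightarrow> r n \<le> r m"
  shows "AE y in lam. y \<in> target_set T x r"
proof (rule ergodic_forward_invariant)
  show meas: "target_set T x r \<in> sets borel"
  proof -
    have "{y. infinite {n. 1 \<le> n \<and> dist ((T ^^ n) y) x < r n}}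
        = (\<Inter>m. \<Union>n\<in>{n. m < n \<and> 1 \<le> n}. (T ^^ n) -` ball x (r n))"
      by (auto simp: infinite_nat_iff_unbounded dist_commute)
    also have "\<dots> \<in> sets borel"
      by (intro sets.countable_INT'' sets.countable_UN') auto
    finally show ?thesis by (simp add: target_set_def)
  qed
  show "T y \<in> target_set T x r" if y: "y \<in> target_set T x r" for y
  proof -
    have "\<exists>n>m. 1 \<le> n \<and> dist ((T ^^ n) (T y)) x < r n" for m
    proof -
      have "\<exists>n>Suc (Suc m). 1 \<le> n \<and> dist ((T ^^ n) y) x < r n"
        using y unfolding target_set_def infinite_nat_iff_unbounded by blast
      then obtain n where n: "n > Suc (Suc m)" "dist ((T ^^ n) y) x < r n"
        by blast
      then obtain k where k: "n = Suc k" "k > Suc m" by (cases n) auto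
      have "r n \<le> r k" using k by (intro mono) auto
      moreover have "(T ^^ n) y = (T ^^ k) (T y)" by (simp add: k funpow_Suc_right del: funpow.simps)
      ultimately show ?thesis using n k by (intro exI[of _ k]) auto
    qed
    then show ?thesis unfolding target_set_def infinite_nat_iff_unbounded by blast
  qed
  have "{y. infinite {n. (T ^^ n) y \<in> bl (N n) x}} \<subseteq> target_set T x r"
  proof safe
    fix y assume inf: "infinite {n. (T ^^ n) y \<in> bl (N n) x}"
    have "{n. (T ^^ n) y \<in> bl (N n) x} - {0} \<subseteq> {n. 1 \<le> n \<and> dist ((T ^^ n) y) x < r n}"
    proof
      fix n assume "n \<in> {n. (T ^^ n) y \<in> bl (N n) x} - {0}"
      then show "n \<in> {n. 1 \<le> n \<and> dist ((T ^^ n) y) x < r n}"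
        using sub[of n] by (auto simp: dist_commute)
    qed
    then have "infinite {n. 1 \<le> n \<and> dist ((T ^^ n) y) x < r n}"
      using infinite_remove[OF inf, of 0] infinite_super by blast
    then show "y \<in> target_set T x r" by (simp add: target_set_def)
  qed
  then have "measure lam {y. infinite {n. (T ^^ n) y \<in> bl (N n) x}} \<le> measure lam (target_set T x r)"
    using meas by (intro finite_measure_mono) simp_all
  then show "0 < measure lam (target_set T x r)"
    by (rule less_le_trans[OF block_limsup_positive[OF x div]])
qed

end

section \<open>Entropy and block measures\<close>

context expanding_system_acipm
begin

lemma mu_P0_pos: "Q \<in> P0 \<Longrightarrow> 0 < measure mu Q"
proof -
  assume Q: "Q \<in> P0"
  have "Q \<notin> null_sets mu"
    using lam_ac positive_partition Q by (force simp: absolutely_continuous_def)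
  then show ?thesis
    using blocks_borel[of Q 0] Q by (auto simp: zero_less_measure_iff mu.emeasure_eq_measure null_sets_def)
qed

lemma countable_P0_subset: "countable {Q \<in> P0. P Q}"
  using countable_P0 by (rule countable_subset[rotated]) auto

lemma Union_P0_subset_borel [measurable]: "\<Union>{Q \<in> P0. P Q} \<in> sets borel"
  using blocks_borel[of _ 0] countable_P0_subset by (intro sets.countable_Union) auto

text \<open>Only indices below \<open>ln (1 / p) / \<epsilon>\<close> are counted, and the 1 allows
  for the index 0. Weighted by the measures of the cells, this count becomes the entropy.\<close>

lemma card_exp_less_le:
  fixes p \<epsilon> :: real
  assumes p: "0 < p" "p \<le> 1" and \<epsilon>: "0 < \<epsilon>"
  shows "(\<Sum>n<N. if p < exp (- \<epsilon> * real n) then 1 else 0) \<le> 1 + ln (1 / p) / \<epsilon>"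
proof -
  define b where "b = ln (1 / p) / \<epsilon>"
  have b: "0 \<le> b" using p \<epsilon> by (auto simp: b_def ln_div divide_nonpos_pos)
  have sub: "{..<N} \<inter> {n. p < exp (- \<epsilon> * real n)} \<subseteq> {..nat \<lfloor>b\<rfloor>}"
  proof
    fix n assume "n \<in> {..<N} \<inter> {n. p < exp (- \<epsilon> * real n)}"
    then have "ln p < ln (exp (- \<epsilon> * real n))" using p by (subst ln_less_cancel_iff) auto
    then have "ln p < - \<epsilon> * real n" by simp
    then have "real n < b" using p \<epsilon> by (simp add: b_def ln_div field_simps)
    then show "n \<in> {..nat \<lfloor>b\<rfloor>}" by (simp add: le_nat_floor)
  qed
  have "(\<Sum>n<N. if p < exp (- \<epsilon> * real n) then 1 else 0 :: real)
      = real (card ({..<N} \<inter> {n. p < exp (- \<epsilon> * real n)}))"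
    by (simp add: sum.If_cases)
  also have "\<dots> \<le> real (card {..nat \<lfloor>b\<rfloor>})"
    using sub by (intro of_nat_mono card_mono) auto
  also have "\<dots> \<le> 1 + b" using b by simp
  finally show ?thesis by (simp add: b_def)
qed

text \<open>Summing over \<open>n\<close> before summing over the cells, a cell \<open>Q\<close>
  contributes at most its measure times \<open>1 + ln (1 / measure mu Q) / \<epsilon>\<close>, so
  the total is at most 1 plus the entropy divided by \<epsilon>.\<close>

lemma summable_small_cells:
  assumes ent: "partition_entropy mu P0 < \<infinity>" and \<epsilon>: "0 < \<epsilon>"
  shows "summable (\<lambda>n. measure mu (\<Union>{Q \<in> P0. measure mu Q < exp (- \<epsilon> * real n)}))"
proof -
  define A where "A n = \<Union>{Q \<in> P0. measure mu Q < exp (- \<epsilon> * real n)}" for n :: nat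
  define w where "w n Q = (if measure mu Q < exp (- \<epsilon> * real n) then 1 else 0 :: real)" for n :: nat and Q
  define h where "h Q = measure mu Q * ln (1 / measure mu Q)" for Q
  have h0: "0 \<le> h Q" for Q
  proof (cases "measure mu Q = 0")
    case False
    then have "0 < measure mu Q" by (simp add: zero_less_measure_iff)
    then show ?thesis by (simp add: h_def ln_div mult_nonneg_nonpos)
  qed (simp add: h_def)
  have mA: "emeasure mu (A n) = (\<integral>\<^sup>+Q. ennreal (measure mu Q * w n Q) \<partial>count_space P0)" for n
  proof -
    have "A n = (\<Union>Q\<in>P0. if measure mu Q < exp (- \<epsilon> * real n) then Q else {})"
      by (auto simp: A_def)
    also have "emeasure mu \<dots> = (\<integral>\<^sup>+Q. emeasure mu (if measure mu Q < exp (- \<epsilon> * real n) then Q else {}) \<partial>count_space P0)"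
      using blocks_borel[of _ 0] disjoint_partition
      by (intro emeasure_UN_countable countable_P0) (auto simp: disjoint_family_on_def)
    also have "\<dots> = (\<integral>\<^sup>+Q. ennreal (measure mu Q * w n Q) \<partial>count_space P0)"
      by (intro nn_integral_cong) (auto simp: w_def mu.emeasure_eq_measure)
    finally show ?thesis .
  qed
  have one: "(\<integral>\<^sup>+Q. ennreal (measure mu Q) \<partial>count_space P0) \<le> 1"
  proof -
    have "(\<integral>\<^sup>+Q. ennreal (measure mu Q) \<partial>count_space P0) = (\<integral>\<^sup>+Q. emeasure mu Q \<partial>count_space P0)"
      by (simp add: mu.emeasure_eq_measure)
    also have "\<dots> = emeasure mu (\<Union>Q\<in>P0. Q)"
      using blocks_borel[of _ 0] disjoint_partition
      by (intro emeasure_UN_countable[symmetric] countable_P0) (auto simp: disjoint_family_on_def)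
    also have "\<dots> \<le> 1" by (rule mu.emeasure_le_1)
    finally show ?thesis .
  qed
  have hfin: "(\<integral>\<^sup>+Q. ennreal (h Q) \<partial>count_space P0) < \<infinity>"
    using nn_integral_count_space_le_infsum[OF countable_P0, of "\<lambda>Q. ennreal (h Q)"] ent
    by (simp add: partition_entropy_def h_def)
  define B where "B = 1 + enn2real (\<integral>\<^sup>+Q. ennreal (h Q) \<partial>count_space P0) / \<epsilon>"
  have "summable (\<lambda>n. measure mu (A n))"
  proof (rule summableI_nonneg_bounded)
    fix N
    have "ennreal (\<Sum>n<N. measure mu (A n)) = (\<Sum>n<N. emeasure mu (A n))"
      by (simp add: mu.emeasure_eq_measure)
    also have "\<dots> = (\<integral>\<^sup>+Q. (\<Sum>n<N. ennreal (measure mu Q * w n Q)) \<partial>count_space P0)"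
      unfolding mA by (subst nn_integral_sum) auto
    also have "\<dots> \<le> (\<integral>\<^sup>+Q. ennreal (measure mu Q) + ennreal (1 / \<epsilon>) * ennreal (h Q) \<partial>count_space P0)"
    proof (rule nn_integral_mono)
      fix Q assume "Q \<in> space (count_space P0)"
      then have p: "0 < measure mu Q" using mu_P0_pos by simp
      have "(\<Sum>n<N. measure mu Q * w n Q) = measure mu Q * (\<Sum>n<N. w n Q)"
        by (simp add: sum_distrib_left)
      also have "\<dots> \<le> measure mu Q * (1 + ln (1 / measure mu Q) / \<epsilon>)"
        unfolding w_def using p \<epsilon> by (intro mult_left_mono card_exp_less_le) auto
      also have "\<dots> = measure mu Q + 1 / \<epsilon> * h Q" by (simp add: h_def algebra_simps)
      finally have "ennreal (\<Sum>n<N. measure mu Q * w n Q) \<le> ennreal (measure mu Q + 1 / \<epsilon> * h Q)"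
        by (rule ennreal_leI)
      also have "\<dots> = ennreal (measure mu Q) + ennreal (1 / \<epsilon>) * ennreal (h Q)"
        using \<epsilon> h0[of Q] by (simp add: ennreal_mult[symmetric] ennreal_plus[symmetric] del: ennreal_plus)
      finally show "(\<Sum>n<N. ennreal (measure mu Q * w n Q)) \<le> ennreal (measure mu Q) + ennreal (1 / \<epsilon>) * ennreal (h Q)"
        by (simp add: w_def)
    qed
    also have "\<dots> = (\<integral>\<^sup>+Q. ennreal (measure mu Q) \<partial>count_space P0)
        + ennreal (1 / \<epsilon>) * (\<integral>\<^sup>+Q. ennreal (h Q) \<partial>count_space P0)"
      by (simp add: nn_integral_add nn_integral_cmult)
    also have "\<dots> \<le> 1 + ennreal (1 / \<epsilon>) * ennreal (enn2real (\<integral>\<^sup>+Q. ennreal (h Q) \<partial>count_space P0))"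
      using one hfin by (intro add_mono) (auto simp: less_top)
    also have "\<dots> = ennreal B"
      using \<epsilon> by (simp add: B_def ennreal_mult[symmetric] ennreal_1[symmetric] ennreal_plus[symmetric]
          del: ennreal_plus ennreal_1)
    finally show "(\<Sum>n<N. measure mu (A n)) \<le> B"
      using \<epsilon> by (subst (asm) ennreal_le_iff) (auto simp: B_def)
  qed simp
  then show ?thesis by (simp add: A_def)
qed

text \<open>By invariance, meeting a small cell at time \<open>n\<close> is as likely for
  \<open>mu\<close> as at time 0, so the convergence half of Borel--Cantelli applies;
  \<open>lam_ac\<close> transfers the result.\<close>

lemma AE_cell_lower:
  assumes ent: "partition_entropy mu P0 < \<infinity>" and \<epsilon>: "0 < \<epsilon>"
  shows "AE x in lam. \<forall>\<^sub>F n in sequentially. exp (- \<epsilon> * real n) \<le> measure mu (bl 0 ((T ^^ n) x))"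
proof -
  define A where "A n = \<Union>{Q \<in> P0. measure mu Q < exp (- \<epsilon> * real n)}" for n :: nat
  have AB [measurable]: "A n \<in> sets borel" for n unfolding A_def by measurable
  have eq: "measure mu ((T ^^ n) -` A n) = measure mu (A n)" for n
    using emeasure_mu_vimage_funpow[OF AB] by (simp add: measure_def)
  have "AE x in mu. \<forall>\<^sub>F n in sequentially. x \<in> space mu - (T ^^ n) -` A n"
  proof (rule borel_cantelli_AE1)
    show "summable (\<lambda>n. measure mu ((T ^^ n) -` A n))"
      unfolding eq unfolding A_def by (rule summable_small_cells[OF ent \<epsilon>])
  qed (auto simp: mu.emeasure_eq_measure)
  from AE_mu_imp_lam[OF this] AE_X0 show ?thesis
  proof eventually_elim
    case (elim x)
    from elim(1) show ?case
    proof eventually_elim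
      case n: (elim n)
      have "bl 0 ((T ^^ n) x) \<in> P0" "(T ^^ n) x \<in> bl 0 ((T ^^ n) x)"
        using X0_block[of "(T ^^ n) x" 0] X0_mem_block[of "(T ^^ n) x" 0] X0_funpow[OF elim(2)] by auto
      then show ?case using n by (force simp: A_def not_less)
    qed
  qed
qed

lemma finite_large_cells:
  assumes t: "0 < t"
  shows "finite {Q \<in> P0. t \<le> measure mu Q}" and "real (card {Q \<in> P0. t \<le> measure mu Q}) \<le> 1 / t"
proof -
  have bound: "real (card F) \<le> 1 / t" if F: "finite F" "F \<subseteq> {Q \<in> P0. t \<le> measure mu Q}" for F
  proof -
    have "real (card F) * t \<le> (\<Sum>Q\<in>F. measure mu Q)"
      using F sum_bounded_below[of F t "measure mu"] by auto
    also have "\<dots> = measure mu (\<Union>Q\<in>F. Q)"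
      using F blocks_borel[of _ 0] disjoint_partition
      by (intro mu.finite_measure_finite_Union[symmetric]) (auto simp: disjoint_family_on_def subset_eq)
    also have "\<dots> \<le> 1" by simp
    finally show ?thesis using t by (simp add: field_simps)
  qed
  show fin: "finite {Q \<in> P0. t \<le> measure mu Q}"
  proof (rule ccontr)
    assume inf: "infinite {Q \<in> P0. t \<le> measure mu Q}"
    obtain n where n: "1 / t < real n" using reals_Archimedean2 by blast
    obtain F where "finite F" "card F = n" "F \<subseteq> {Q \<in> P0. t \<le> measure mu Q}"
      using infinite_arbitrarily_large[OF inf] by blast
    then show False using bound[of F] n by auto
  qed
  show "real (card {Q \<in> P0. t \<le> measure mu Q}) \<le> 1 / t"
    using bound[OF fin] by auto
qed

text \<open>
  The density of \<open>mu\<close> need not be bounded, so a lower bound for \<open>mu\<close> says nothing about \<open>lam\<close>.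
  Instead, entropy restricts \<open>T x\<close> to at most \<open>1 / t\<close> cells, and among the parts of a cell \<open>Q\<close>
  mapping into one of these, those of relative measure below \<open>s\<close> fill at most \<open>s / t\<close> of \<open>Q\<close>.
\<close>

lemma thin_parts_measure:
  assumes s: "0 \<le> s" and t: "0 < t"
  defines "B \<equiv> \<Union>Q\<in>P0. \<Union>Q'\<in>{Q' \<in> P0. t \<le> measure mu Q' \<and> measure lam (Q \<inter> T -` Q') < s * measure lam Q}. Q \<inter> T -` Q'"
  shows "B \<in> sets borel" "measure lam ((T ^^ n) -` B) \<le> distortion * s / t * measure lam UNIV"
proof -
  define I where "I Q = {Q' \<in> P0. t \<le> measure mu Q' \<and> measure lam (Q \<inter> T -` Q') < s * measure lam Q}" for Q
  have I: "finite (I Q)" "real (card (I Q)) \<le> 1 / t" for Q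
  proof -
    have sub: "I Q \<subseteq> {Q \<in> P0. t \<le> measure mu Q}" by (auto simp: I_def)
    then show "finite (I Q)" using finite_large_cells(1)[OF t] finite_subset by blast
    have "real (card (I Q)) \<le> real (card {Q \<in> P0. t \<le> measure mu Q})"
      using card_mono[OF finite_large_cells(1)[OF t] sub] by simp
    also have "\<dots> \<le> 1 / t" by (rule finite_large_cells(2)[OF t])
    finally show "real (card (I Q)) \<le> 1 / t" .
  qed
  have P0B [simp]: "Q \<in> P0 \<Longrightarrow> Q \<in> sets borel" for Q using blocks_borel[of Q 0] by simp
  have part: "Q \<in> P0 \<Longrightarrow> Q' \<in> I Q \<Longrightarrow> Q \<inter> T -` Q' \<in> sets borel" for Q Q'
    by (auto simp: I_def intro!: sets.Int vimage_T)
  have Beq: "B = (\<Union>Q\<in>P0. \<Union>Q'\<in>I Q. Q \<inter> T -` Q')" by (simp add: B_def I_def)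
  show B: "B \<in> sets borel"
    unfolding Beq by (intro sets.countable_UN'' sets.finite_UN countable_P0 I(1) part)
  have QB: "measure lam (Q \<inter> B) \<le> s / t * measure lam Q" if Q: "Q \<in> P0" for Q
  proof -
    have "Q \<inter> B \<subseteq> (\<Union>Q'\<in>I Q. Q \<inter> T -` Q')"
    proof
      fix x assume x: "x \<in> Q \<inter> B"
      then obtain Q1 where Q1: "Q1 \<in> P0" "x \<in> Q1" "x \<in> (\<Union>Q'\<in>I Q1. Q1 \<inter> T -` Q')" unfolding Beq by blast
      then have "Q1 = Q" using x Q by (intro blocks_unique[of Q1 0 Q x]) auto
      then show "x \<in> (\<Union>Q'\<in>I Q. Q \<inter> T -` Q')" using Q1 by simp
    qed
    moreover have "(\<Union>Q'\<in>I Q. Q \<inter> T -` Q') \<in> sets borel"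
      by (intro sets.finite_UN I(1) part[OF Q])
    ultimately have "measure lam (Q \<inter> B) \<le> measure lam (\<Union>Q'\<in>I Q. Q \<inter> T -` Q')"
      by (intro finite_measure_mono) simp_all
    also have "\<dots> \<le> (\<Sum>Q'\<in>I Q. measure lam (Q \<inter> T -` Q'))"
      using part[OF Q] I(1) by (intro measure_UNION_le) auto
    also have "\<dots> \<le> (\<Sum>Q'\<in>I Q. s * measure lam Q)"
      by (intro sum_mono) (auto simp: I_def)
    also have "\<dots> = real (card (I Q)) * (s * measure lam Q)" by simp
    also have "\<dots> \<le> 1 / t * (s * measure lam Q)"
      using s I(2) by (intro mult_right_mono) auto
    finally show ?thesis by simp
  qed
  have "measure lam (UNIV \<inter> (T ^^ n) -` B) \<le> (distortion * s / t) * measure lam (UNIV \<inter> UNIV)"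
  proof (rule saturated_measure_mono[OF saturated_UNIV])
    fix S assume S: "S \<in> Bl n"
    let ?Q = "(T ^^ n) ` S"
    have Q: "?Q \<in> P0" by (rule blocks_image[OF S])
    have Qpos: "0 < measure lam ?Q" using blocks_positive[of ?Q 0] Q by simp
    have "measure lam (S \<inter> (T ^^ n) -` B) * measure lam ?Q
        \<le> distortion * (measure lam S * measure lam (?Q \<inter> B))"
      by (rule block_pullback(1)[OF S B])
    also have "\<dots> \<le> distortion * (measure lam S * (s / t * measure lam ?Q))"
      using distortion_pos QB[OF Q] by (intro mult_left_mono) auto
    also have "\<dots> = (distortion * s / t * measure lam S) * measure lam ?Q" by simp
    finally show "measure lam (S \<inter> (T ^^ n) -` B) \<le> distortion * s / t * measure lam (S \<inter> UNIV)"
      using Qpos by (subst (asm) mult_le_cancel_right_pos) auto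
  qed (use B s t distortion_pos in auto)
  then show "measure lam ((T ^^ n) -` B) \<le> distortion * s / t * measure lam UNIV" by simp
qed

text \<open>Let \<open>y\<close> be the \<open>n\<close>-th iterate of \<open>x\<close>. Distortion
  compares the shrinking from \<open>bl n x\<close> to \<open>bl (Suc n) x\<close> with that from
  \<open>bl 0 y\<close> to \<open>bl 1 y\<close>. The latter is too strong only if \<open>y\<close>
  lies in a thin part or \<open>T y\<close> in a small cell. Almost surely each happens finitely
  often, the first by Borel--Cantelli for \<open>lam\<close>, the second by
  \<open>AE_cell_lower\<close>.\<close>

lemma AE_block_ratio:
  assumes ent: "partition_entropy mu P0 < \<infinity>" and \<epsilon>: "0 < \<epsilon>"
  shows "AE x in lam. \<forall>\<^sub>F n in sequentially.
    exp (- \<epsilon> * real n) * measure lam (bl n x) \<le> distortion * measure lam (bl (Suc n) x)"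
proof -
  \<comment> \<open>Half the rate in \<open>t\<close> makes \<open>s n / t n\<close> geometric;
    \<open>Suc n\<close> appears because \<open>t n\<close> is compared with the cell visited at
    time \<open>Suc n\<close>.\<close>
  define s t where "s n = exp (- \<epsilon> * real n)" and "t n = exp (- (\<epsilon> / 2) * real (Suc n))" for n
  define B where "B n = (\<Union>Q\<in>P0. \<Union>Q'\<in>{Q' \<in> P0. t n \<le> measure mu Q' \<and>
      measure lam (Q \<inter> T -` Q') < s n * measure lam Q}. Q \<inter> T -` Q')" for n
  have B: "B n \<in> sets borel" "measure lam ((T ^^ n) -` B n) \<le> distortion * s n / t n * measure lam UNIV" for n
    unfolding B_def using thin_parts_measure[of "s n" "t n"] by (auto simp: s_def t_def)
  have "AE x in lam. \<forall>\<^sub>F n in sequentially. x \<in> space lam - (T ^^ n) -` B n"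
  proof (rule borel_cantelli_AE1)
    have "distortion * s n / t n * measure lam UNIV
        = (distortion * exp (\<epsilon> / 2) * measure lam UNIV) * exp (- (\<epsilon> / 2)) ^ n" for n
      unfolding s_def t_def by (simp add: exp_of_nat_mult[symmetric] exp_diff[symmetric] exp_add[symmetric] field_simps)
    then have le: "norm (measure lam ((T ^^ n) -` B n))
        \<le> (distortion * exp (\<epsilon> / 2) * measure lam UNIV) * exp (- (\<epsilon> / 2)) ^ n" for n
      using B(2)[of n] by simp
    have "summable (\<lambda>n. (distortion * exp (\<epsilon> / 2) * measure lam UNIV) * exp (- (\<epsilon> / 2)) ^ n)"
      using \<epsilon> by (intro summable_mult summable_geometric) auto
    then show "summable (\<lambda>n. measure lam ((T ^^ n) -` B n))"
      by (rule summable_comparison_test'[where N = 0]) (rule le)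
    show "(T ^^ n) -` B n \<in> sets lam" for n using vimage_funpow[OF B(1)] by simp
    show "emeasure lam ((T ^^ n) -` B n) < \<infinity>" for n by (simp add: emeasure_eq_measure)
  qed
  moreover have "AE x in lam. \<forall>\<^sub>F n in sequentially.
      exp (- (\<epsilon> / 2) * real n) \<le> measure mu (bl 0 ((T ^^ n) x))"
    using \<epsilon> by (intro AE_cell_lower[OF ent]) auto
  ultimately show ?thesis
    using AE_X0
  proof eventually_elim
    case (elim x)
    have "\<forall>\<^sub>F n in sequentially. exp (- (\<epsilon> / 2) * real (Suc n)) \<le> measure mu (bl 0 ((T ^^ Suc n) x))"
      using elim(2) by (subst (asm) eventually_sequentially_Suc[symmetric])
    with elim(1) show ?case
    proof eventually_elim
      case n: (elim n)
      define y where "y = (T ^^ n) x"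
      have y: "y \<in> X0" unfolding y_def by (rule X0_funpow[OF elim(3)])
      let ?Q = "bl 0 y" and ?Q' = "bl 0 (T y)"
      have Q: "?Q \<in> P0" "y \<in> ?Q" "?Q' \<in> P0" "T y \<in> ?Q'"
        using X0_block[OF y, of 0] X0_mem_block[OF y, of 0]
          X0_block[OF X0_T[OF y], of 0] X0_mem_block[OF X0_T[OF y], of 0] by auto
      have "?Q \<inter> T -` ?Q' \<in> Bl (Suc 0)"
      proof -
        have "?Q' \<subseteq> T ` ?Q" using Q by (intro blocks_in_image[of ?Q' 0]) auto
        then show ?thesis unfolding blocks_Suc_iff using Q by auto
      qed
      then have bl1: "bl 1 y = ?Q \<inter> T -` ?Q'" using Q by (intro block_eqI) auto
      have "y \<notin> B n" using n(1) by (simp add: y_def)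
      moreover have "t n \<le> measure mu ?Q'" using n(2) by (simp add: t_def y_def)
      ultimately have "s n * measure lam ?Q \<le> measure lam (bl 1 y)"
        using Q unfolding B_def bl1 by (auto simp: not_less)
      then have "s n * measure lam ?Q * measure lam (bl n x) \<le> measure lam (bl 1 y) * measure lam (bl n x)"
        by (intro mult_right_mono) auto
      also have "\<dots> \<le> distortion * measure lam ?Q * measure lam (bl (Suc n) x)"
      proof -
        have im: "(T ^^ n) ` bl (1 + n) x = bl 1 y" "(T ^^ n) ` bl (0 + n) x = ?Q"
          unfolding y_def by (rule funpow_image_block[OF elim(3)])+
        have "measure lam ((T ^^ n) ` bl (Suc n) x) * measure lam (bl n x)
            \<le> distortion * measure lam ((T ^^ n) ` bl n x) * measure lam (bl (Suc n) x)"
          using blocks_borel[OF X0_block[OF elim(3)]] block_antimono[OF elim(3), of n "Suc n"]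
          by (intro bounded_distortion[OF X0_block[OF elim(3)]]) auto
        then show ?thesis using im by simp
      qed
      finally have "measure lam ?Q * (s n * measure lam (bl n x))
          \<le> measure lam ?Q * (distortion * measure lam (bl (Suc n) x))"
        by (simp add: algebra_simps)
      then show ?case
        using blocks_positive[of ?Q 0] Q by (simp add: s_def)
    qed
  qed
qed

end

section \<open>Upper dimension and blocks inside balls\<close>

context expanding_system
begin

lemma bounded_block: "S \<in> Bl n \<Longrightarrow> bounded S"
  using blocks_subset_partition[of S n] diameter_partition by (meson bounded_subset)

lemma diameter_block_pos:
  assumes x: "x \<in> X0"
  shows "0 < diameter (bl n x)"
proof -
  have "\<not> bl n x \<subseteq> {x}"
  proof
    assume "bl n x \<subseteq> {x}"
    then have "measure lam (bl n x) \<le> measure lam {x}" by (intro finite_measure_mono) auto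
    then show False using measure_singleton blocks_positive[OF X0_block[OF x, of n]] by simp
  qed
  then obtain y where y: "y \<in> bl n x" "y \<noteq> x" by blast
  then have "dist x y \<le> diameter (bl n x)"
    using X0_mem_block[OF x] by (intro diameter_bounded_bound bounded_block[OF X0_block[OF x]]) auto
  then show ?thesis using y by (metis dist_pos_lt less_le_trans)
qed

text \<open>Eventually the logarithm of the diameter is negative, so clearing the denominator
  reverses the inequality. The logarithm of the measure is eventually negative as well, which makes
  the quotient, and with it \<open>d\<close>, positive.\<close>

lemma eventually_measure_block_ge:
  assumes x: "x \<in> X0" and dim: "upper_dim lam T P0 x < ereal d"
  shows "\<forall>\<^sub>F n in sequentially. diameter (bl n x) powr d \<le> measure lam (bl n x)" and "0 < d"
proof -
  obtain C \<beta> :: real where C: "0 < C" "1 < \<beta>"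
    "\<And>n S x y. S \<in> Bl n \<Longrightarrow> x \<in> S \<Longrightarrow> y \<in> S \<Longrightarrow> dist x y \<le> C / \<beta> ^ n"
    by (rule block_diameter_bound) blast
  have "(\<lambda>n. C / \<beta> ^ n) \<longlonglongrightarrow> 0"
    using C(2) by (rule LIMSEQ_divide_realpow_zero)
  then have "\<forall>\<^sub>F n in sequentially. C / \<beta> ^ n < 1"
    by (rule order_tendstoD) simp
  moreover have "diameter (bl n x) \<le> C / \<beta> ^ n" for n
    unfolding diameter_def using X0_mem_block[OF x, of n] C(3)[OF X0_block[OF x]]
    by (auto intro!: cSUP_least)
  ultimately have small: "\<forall>\<^sub>F n in sequentially. diameter (bl n x) < 1"
    by (auto elim!: eventually_mono intro: le_less_trans)
  have msmall: "\<forall>\<^sub>F n in sequentially. measure lam (bl n x) < 1"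
    using block_measure_tendsto_0[OF x] by (rule order_tendstoD) simp
  have ratio: "\<forall>\<^sub>F n in sequentially. ln (measure lam (bl n x)) / ln (diameter (bl n x)) < d"
    using Limsup_lessD[OF dim[unfolded upper_dim_def]] by simp
  have pos: "0 < measure lam (bl n x)" "0 < diameter (bl n x)" for n
    using blocks_positive[OF X0_block[OF x]] diameter_block_pos[OF x] by auto
  show "\<forall>\<^sub>F n in sequentially. diameter (bl n x) powr d \<le> measure lam (bl n x)"
    using small ratio
  proof eventually_elim
    case (elim n)
    have "ln (diameter (bl n x)) < 0" using elim pos by simp
    then have "d * ln (diameter (bl n x)) < ln (measure lam (bl n x))"
      using elim(2) by (simp add: neg_divide_less_eq)
    then have "exp (d * ln (diameter (bl n x))) \<le> measure lam (bl n x)"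
      using pos(1)[of n] by (metis exp_le_cancel_iff exp_ln less_imp_le)
    then show ?case using pos(2)[of n] by (simp add: powr_def)
  qed
  have "\<forall>\<^sub>F n in sequentially. 0 < d"
    using small msmall ratio
  proof eventually_elim
    case (elim n)
    have "0 < ln (measure lam (bl n x)) / ln (diameter (bl n x))"
      using elim pos by (simp add: zero_less_divide_iff)
    then show ?case using elim(3) by linarith
  qed
  then show "0 < d" by simp
qed

text \<open>
  The ball of radius \<open>\<rho>\<close> contains a block whose predecessor does not fit into it and hence has
  diameter at least \<open>\<rho>\<close>. Passing from the predecessor to the block costs a factor \<open>exp (- \<epsilon> n)\<close>,
  which is absorbed by \<open>\<rho> powr (\<delta> - d)\<close>, as \<open>\<rho> \<le> C / \<beta> ^ n\<close>.
\<close>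

lemma ball_block_measure:
  assumes x: "x \<in> X0" and dim: "upper_dim lam T P0 x < ereal \<delta>" and K: "0 < K"
    and ratio: "\<And>\<epsilon>. 0 < \<epsilon> \<Longrightarrow> \<forall>\<^sub>F n in sequentially.
      exp (- \<epsilon> * real n) * measure lam (bl n x) \<le> K * measure lam (bl (Suc n) x)"
  obtains N0 where "\<And>\<rho>. 0 < \<rho> \<Longrightarrow>
    \<exists>n. bl n x \<subseteq> ball x \<rho> \<and> (n \<le> N0 \<or> \<rho> powr \<delta> \<le> measure lam (bl n x))"
proof -
  obtain d where d: "upper_dim lam T P0 x < ereal d" "ereal d < ereal \<delta>"
    using ereal_dense2[OF dim] by blast
  have d0: "0 < d" by (rule eventually_measure_block_ge(2)[OF x d(1)])
  define s where "s = \<delta> - d"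
  have s: "0 < s" using d(2) by (simp add: s_def)
  obtain C \<beta> :: real where C: "0 < C" "1 < \<beta>"
    "\<And>n S x y. S \<in> Bl n \<Longrightarrow> x \<in> S \<Longrightarrow> y \<in> S \<Longrightarrow> dist x y \<le> C / \<beta> ^ n"
    by (rule block_diameter_bound) blast
  \<comment> \<open>Half of the decay rate \<open>s * ln \<beta>\<close> of
    \<open>(C / \<beta> ^ n) powr s\<close> pays for the loss between consecutive levels; the other
    half swallows the constants \<open>K\<close> and \<open>C powr s\<close>.\<close>
  define \<epsilon> where "\<epsilon> = s * ln \<beta> / 2"
  have \<epsilon>: "0 < \<epsilon>" using s C by (simp add: \<epsilon>_def)
  have absorb: "K * (C / \<beta> ^ n) powr s = K * C powr s * exp (- \<epsilon>) ^ n * exp (- \<epsilon> * real n)" for n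
  proof -
    have "(C / \<beta> ^ n) powr s = C powr s * (1 / \<beta> ^ n) powr s"
      using C by (subst powr_mult[symmetric]) auto
    also have "(1 / \<beta> ^ n) powr s = exp (- (s * ln \<beta>) * real n)"
      using C by (simp add: powr_def ln_div ln_realpow algebra_simps)
    also have "\<dots> = exp (- \<epsilon>) ^ n * exp (- \<epsilon> * real n)"
      by (simp add: \<epsilon>_def exp_of_nat_mult[symmetric] exp_add[symmetric] field_simps)
    finally show ?thesis by (simp add: algebra_simps)
  qed
  have "(\<lambda>n. K * C powr s * exp (- \<epsilon>) ^ n) \<longlonglongrightarrow> K * C powr s * 0"
    using \<epsilon> by (intro tendsto_mult tendsto_const LIMSEQ_realpow_zero) auto
  then have "\<forall>\<^sub>F n in sequentially. K * C powr s * exp (- \<epsilon>) ^ n < 1"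
    by (intro order_tendstoD) auto
  then have "\<forall>\<^sub>F n in sequentially. K * C powr s * exp (- \<epsilon>) ^ n < 1 \<and>
      exp (- \<epsilon> * real n) * measure lam (bl n x) \<le> K * measure lam (bl (Suc n) x) \<and>
      diameter (bl n x) powr d \<le> measure lam (bl n x)"
    using ratio[OF \<epsilon>] eventually_measure_block_ge(1)[OF x d(1)] by eventually_elim auto
  then obtain N0 where N0: "\<And>n. N0 \<le> n \<Longrightarrow> K * C powr s * exp (- \<epsilon>) ^ n < 1"
    "\<And>n. N0 \<le> n \<Longrightarrow> exp (- \<epsilon> * real n) * measure lam (bl n x) \<le> K * measure lam (bl (Suc n) x)"
    "\<And>n. N0 \<le> n \<Longrightarrow> diameter (bl n x) powr d \<le> measure lam (bl n x)"
    unfolding eventually_sequentially by blast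
  have "\<exists>n. bl n x \<subseteq> ball x \<rho> \<and> (n \<le> N0 \<or> \<rho> powr \<delta> \<le> measure lam (bl n x))" if \<rho>: "0 < \<rho>" for \<rho>
  proof -
    have "\<forall>\<^sub>F n in sequentially. bl n x \<subseteq> ball x \<rho>"
      using \<rho> by (intro block_subset_open[OF x]) auto
    then have ex: "\<exists>n. bl n x \<subseteq> ball x \<rho>" by (auto simp: eventually_sequentially)
    define n where "n = (LEAST n. bl n x \<subseteq> ball x \<rho>)"
    have n: "bl n x \<subseteq> ball x \<rho>" unfolding n_def using ex by (rule LeastI_ex)
    show ?thesis
    proof (cases "n \<le> N0")
      case True
      then show ?thesis using n by blast
    next
      case False
      then obtain m where m: "n = Suc m" "N0 \<le> m" by (cases n) auto
      then have "\<not> bl m x \<subseteq> ball x \<rho>" using not_less_Least[of m "\<lambda>n. bl n x \<subseteq> ball x \<rho>"] by (simp add: n_def)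
      then obtain y where y: "y \<in> bl m x" "\<rho> \<le> dist x y" by (auto simp: subset_eq not_less)
      have "dist x y \<le> diameter (bl m x)"
        using y X0_mem_block[OF x] by (intro diameter_bounded_bound bounded_block[OF X0_block[OF x]]) auto
      then have \<rho>1: "\<rho> \<le> diameter (bl m x)" using y by linarith
      have \<rho>2: "\<rho> \<le> C / \<beta> ^ m"
        using C(3)[OF X0_block[OF x] X0_mem_block[OF x] y(1)] y(2) by linarith
      have "K * \<rho> powr s \<le> K * (C / \<beta> ^ m) powr s"
        using \<rho> \<rho>2 s K by (intro mult_left_mono powr_mono2) auto
      also have "\<dots> \<le> 1 * exp (- \<epsilon> * real m)"
        unfolding absorb using N0(1)[OF m(2)] by (intro mult_right_mono) auto
      finally have e: "K * \<rho> powr s \<le> exp (- \<epsilon> * real m)" by simp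
      have "K * \<rho> powr \<delta> = K * \<rho> powr s * \<rho> powr d"
        by (simp add: s_def powr_add[symmetric])
      also have "\<dots> \<le> exp (- \<epsilon> * real m) * diameter (bl m x) powr d"
        using e \<rho> \<rho>1 d0 by (intro mult_mono powr_mono2) auto
      also have "\<dots> \<le> exp (- \<epsilon> * real m) * measure lam (bl m x)"
        using N0(3)[OF m(2)] by (intro mult_left_mono) auto
      also have "\<dots> \<le> K * measure lam (bl n x)" using N0(2)[OF m(2)] m by simp
      finally have "\<rho> powr \<delta> \<le> measure lam (bl n x)" using K by simp
      then show ?thesis using n by blast
    qed
  qed
  then show ?thesis by (rule that)
qed

end

section \<open>Assembly: from divergence of the series to full measure\<close>

context expanding_system_acipm
begin

lemma AE_target_set_of_dim:
  assumes x: "x \<in> X0" and dim: "upper_dim lam T P0 x < ereal \<delta>"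
    and ratio: "\<And>\<epsilon>. 0 < \<epsilon> \<Longrightarrow> \<forall>\<^sub>F n in sequentially.
      exp (- \<epsilon> * real n) * measure lam (bl n x) \<le> distortion * measure lam (bl (Suc n) x)"
    and pos: "\<And>n. 1 \<le> n \<Longrightarrow> 0 < r n"
    and mono: "\<And>m n. 1 \<le> m \<Longrightarrow> m \<le> n \<Longrightarrow> r n \<le> r m"
    and div: "\<not> summable (\<lambda>n. r (Suc n) powr \<delta>)"
  shows "AE y in lam. y \<in> target_set T x r"
proof -
  obtain N0 where N0: "\<And>\<rho>. 0 < \<rho> \<Longrightarrow>
      \<exists>n. bl n x \<subseteq> ball x \<rho> \<and> (n \<le> N0 \<or> \<rho> powr \<delta> \<le> measure lam (bl n x))"
    by (rule ball_block_measure[OF x dim distortion_pos ratio]) blast+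
  have "\<exists>N. 1 \<le> n \<longrightarrow> bl N x \<subseteq> ball x (r n) \<and> (N \<le> N0 \<or> r n powr \<delta> \<le> measure lam (bl N x))" for n
    using N0[OF pos] by blast
  then obtain N where N: "\<And>n. 1 \<le> n \<Longrightarrow> bl (N n) x \<subseteq> ball x (r n)"
    "\<And>n. 1 \<le> n \<Longrightarrow> N n \<le> N0 \<or> r n powr \<delta> \<le> measure lam (bl (N n) x)"
    by metis
  have \<delta>: "0 < \<delta>" by (rule eventually_measure_block_ge(2)[OF x dim])
  \<comment> \<open>If only \<open>N n \<le> N0\<close> is known, the chosen block contains
    \<open>bl N0 x\<close> while \<open>r n \<le> r 1\<close>; the second entry handles these
    \<open>n\<close>, so \<open>r\<close> need not tend to 0.\<close>
  define c where "c = min 1 (measure lam (bl N0 x) / r 1 powr \<delta>)"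
  have r1: "0 < r 1 powr \<delta>" using pos[of 1] by simp
  have c: "0 < c" using blocks_positive[OF X0_block[OF x, of N0]] r1 by (simp add: c_def)
  have lower: "c * r n powr \<delta> \<le> measure lam (bl (N n) x)" if n: "1 \<le> n" for n
  proof (cases "N n \<le> N0")
    case True
    have "c * r n powr \<delta> \<le> measure lam (bl N0 x) / r 1 powr \<delta> * r 1 powr \<delta>"
      using pos[OF n] mono[of 1 n] n \<delta> r1
      by (intro mult_mono powr_mono2) (auto simp: c_def)
    also have "\<dots> = measure lam (bl N0 x)" using r1 by simp
    also have "\<dots> \<le> measure lam (bl (N n) x)"
      using block_antimono[OF x True] blocks_borel[OF X0_block[OF x]] by (intro finite_measure_mono) auto
    finally show ?thesis .
  next
    case False
    have "c * r n powr \<delta> \<le> 1 * r n powr \<delta>" by (intro mult_right_mono) (auto simp: c_def)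
    then show ?thesis using N(2)[OF n] False by simp
  qed
  show ?thesis
  proof (rule AE_target_set[OF x _ N(1) mono])
    show "\<not> summable (\<lambda>n. measure lam (bl (N n) x))"
    proof
      assume "summable (\<lambda>n. measure lam (bl (N n) x))"
      then have "summable (\<lambda>n. measure lam (bl (N (Suc n)) x))" by (subst summable_Suc_iff)
      then have "summable (\<lambda>n. c * r (Suc n) powr \<delta>)"
        by (rule summable_comparison_test'[where N = 0]) (use lower c in auto)
      then show False using div c by (simp add: summable_cmult_iff)
    qed
  qed
qed

text \<open>The rates \<open>inverse (real (Suc i))\<close> reduce the ratio condition to countably
  many requirements on \<open>x0\<close>, fixed before \<delta> is chosen. The lower limit comes
  from applying the hitting result to \<open>c\<close> times \<open>r\<close> for countably many
  small \<open>c\<close>: this keeps monotonicity and multiplies the series by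
  \<open>c powr \<delta>\<close>.\<close>

lemma AE_shrinking_targets:
  assumes ent: "partition_entropy mu P0 < \<infinity>"
    and pos: "\<And>n. 1 \<le> n \<Longrightarrow> 0 < r n"
    and mono: "\<And>m n. 1 \<le> m \<Longrightarrow> m \<le> n \<Longrightarrow> r n \<le> r m"
  shows "AE x0 in lam.
    (\<exists>\<delta>::real. upper_dim lam T P0 x0 < ereal \<delta> \<and> \<not> summable (\<lambda>n. r (Suc n) powr \<delta>)) \<longrightarrow>
      (AE x in lam. x \<in> target_set T x0 r) \<and>
      (AE x in lam. liminf (\<lambda>n. ereal (dist ((T ^^ n) x) x0 / r n)) = 0)"
proof -
  have "AE x in lam. \<forall>i. \<forall>\<^sub>F n in sequentially.
      exp (- inverse (real (Suc i)) * real n) * measure lam (bl n x) \<le> distortion * measure lam (bl (Suc n) x)"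
    unfolding AE_all_countable by (intro allI AE_block_ratio[OF ent]) simp
  then show ?thesis
    using AE_X0
  proof eventually_elim
    case (elim x0)
    have ratio: "\<forall>\<^sub>F n in sequentially.
        exp (- \<epsilon> * real n) * measure lam (bl n x0) \<le> distortion * measure lam (bl (Suc n) x0)"
      if \<epsilon>: "0 < \<epsilon>" for \<epsilon>
    proof -
      obtain i where i: "inverse (real (Suc i)) < \<epsilon>" using reals_Archimedean[OF \<epsilon>] by blast
      from elim(1) have "\<forall>\<^sub>F n in sequentially. exp (- inverse (real (Suc i)) * real n) * measure lam (bl n x0)
          \<le> distortion * measure lam (bl (Suc n) x0)" ..
      then show ?thesis
      proof eventually_elim
        case n: (elim n)
        have "exp (- \<epsilon> * real n) * measure lam (bl n x0)
            \<le> exp (- inverse (real (Suc i)) * real n) * measure lam (bl n x0)"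
          using i by (intro mult_right_mono) (auto intro!: mult_right_mono)
        then show ?case using n by linarith
      qed
    qed
    show ?case
    proof (intro impI)
      assume "\<exists>\<delta>::real. upper_dim lam T P0 x0 < ereal \<delta> \<and> \<not> summable (\<lambda>n. r (Suc n) powr \<delta>)"
      then obtain \<delta> where \<delta>: "upper_dim lam T P0 x0 < ereal \<delta>" "\<not> summable (\<lambda>n. r (Suc n) powr \<delta>)"
        by blast
      have scaled: "AE x in lam. x \<in> target_set T x0 (\<lambda>n. r n * c)" if c: "0 < c" for c
      proof (rule AE_target_set_of_dim[OF elim(2) \<delta>(1) ratio])
        show "1 \<le> n \<Longrightarrow> 0 < r n * c" for n using pos c by simp
        show "1 \<le> m \<Longrightarrow> m \<le> n \<Longrightarrow> r n * c \<le> r m * c" for m n using mono c by simp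
        have "(\<lambda>n. (r (Suc n) * c) powr \<delta>) = (\<lambda>n. c powr \<delta> * r (Suc n) powr \<delta>)"
          using c pos by (auto simp: powr_mult fun_eq_iff less_imp_le)
        then show "\<not> summable (\<lambda>n. (r (Suc n) * c) powr \<delta>)"
          using \<delta>(2) c by (simp add: summable_cmult_iff)
      qed
      have "AE x in lam. \<forall>j. x \<in> target_set T x0 (\<lambda>n. r n * inverse (real (Suc j)))"
        unfolding AE_all_countable by (intro allI scaled) simp
      then have "AE x in lam. liminf (\<lambda>n. ereal (dist ((T ^^ n) x) x0 / r n)) = 0"
      proof eventually_elim
        case x: (elim x)
        let ?q = "\<lambda>n. ereal (dist ((T ^^ n) x) x0 / r n)"
        \<comment> \<open>The bound is only eventual because the sign of \<open>r 0\<close> is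
          unconstrained.\<close>
        have "0 \<le> liminf ?q"
        proof (rule Liminf_bounded)
          show "\<forall>\<^sub>F n in sequentially. 0 \<le> ?q n"
            using eventually_ge_at_top[of 1] by eventually_elim (use pos in \<open>auto simp: less_imp_le\<close>)
        qed
        moreover have "liminf ?q \<le> 0"
        proof (rule ccontr)
          assume "\<not> ?thesis"
          then obtain e where e: "0 < ereal e" "ereal e < liminf ?q"
            using ereal_dense2[of 0 "liminf ?q"] by (auto simp: not_le)
          obtain j where j: "inverse (real (Suc j)) < e" using reals_Archimedean[of e] e by auto
          have "\<forall>\<^sub>F n in sequentially. ereal e < ?q n" using less_LiminfD[OF e(2)] .
          then obtain n0 where n0: "\<And>n. n0 \<le> n \<Longrightarrow> e < dist ((T ^^ n) x) x0 / r n"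
            by (auto simp: eventually_sequentially)
          obtain n where n: "n0 < n" "1 \<le> n" "dist ((T ^^ n) x) x0 < r n * inverse (real (Suc j))"
            using x[rule_format, of j] unfolding target_set_def infinite_nat_iff_unbounded by blast
          have "dist ((T ^^ n) x) x0 < r n * e"
            using n(3) j pos[OF n(2)] by (meson less_trans mult_strict_left_mono)
          then have "dist ((T ^^ n) x) x0 / r n < e"
            using pos[OF n(2)] by (simp add: pos_divide_less_eq mult.commute)
          then show False using n0[of n] n(1) by simp
        qed
        ultimately show ?case by (rule antisym[rotated])
      qed
      moreover have "AE x in lam. x \<in> target_set T x0 r" using scaled[of 1] by simp
      ultimately show "(AE x in lam. x \<in> target_set T x0 r) \<and>
          (AE x in lam. liminf (\<lambda>n. ereal (dist ((T ^^ n) x) x0 / r n)) = 0)" by blast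
    qed
  qed
qed

end

theorem theorem1p1:
  fixes lam mu :: "'a::{metric_space, second_countable_topology} measure"
    and T :: "'a \<Rightarrow> 'a" and P0 :: "'a set set" and r :: "nat \<Rightarrow> real"
  assumes "expanding_system lam T P0"
    and "is_acipm lam T mu"
    and "partition_entropy mu P0 < \<infinity>"
    and "\<And>n. 1 \<le> n \<Longrightarrow> 0 < r n"
    and "\<And>m n. 1 \<le> m \<Longrightarrow> m \<le> n \<Longrightarrow> r n \<le> r m"
  shows "AE x0 in lam.
    (\<exists>\<delta>::real. upper_dim lam T P0 x0 < ereal \<delta> \<and> \<not> summable (\<lambda>n. r (Suc n) powr \<delta>)) \<longrightarrow>
      (AE x in lam. x \<in> target_set T x0 r) \<and>
      (AE x in lam. liminf (\<lambda>n. ereal (dist ((T ^^ n) x) x0 / r n)) = 0)"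
proof -
  interpret expanding_system_acipm lam T P0 mu
    using assms(1,2) by (intro expanding_system_acipm.intro expanding_system_acipm_axioms.intro)
  show ?thesis by (rule AE_shrinking_targets[OF assms(3-5)])
qed

end
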